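(* There exists an absolute constant $c>0$ such that the following holds. For a prime power $q$ let $N=q^2+q+1$, and let $A\in\{-1,1,*\}^{N\times N}$ be the random partial sign matrix with rows indexed by the lines and columns indexed by the points of the projective plane $\mathrm{PG}(2,q)$, where $A_{\ell,p}=*$ if $p\notin\ell$, and the entries $A_{\ell,p}$ with $p\in\ell$ are independent and uniform in $\{-1,1\}$. Then with probability $1-o(1)$ as $q\to\infty$, $$\operatorname{ind}_{\mathbb{Z}_2}(S(A))\le 1\qquad\text{and}\qquad \operatorname{rank}^{\pm}(A)\ge c\sqrt N .$$
   Context: $\mathrm{PG}(2,q)$ is the finite projective plane of order $q$; it has $N=q^2+q+1$ points and $N$ lines, each line contains $q+1$ points, each point lies on $q+1$ lines, and any two distinct lines meet in exactly one point. The sign-rank $\operatorname{rank}^{\pm}(A)$ of a partial sign matrix $A\in\{-1,1,*\}^{M\times N}$ is the smallest integer $d$ for which there exist nonzero vectors $u_1,\dots,u_M\in\mathbb{R}^d$ and $v_1,\dots,v_N\in\mathbb{R}^d$ such that $\operatorname{sign}(\langle u_i,v_j\rangle)=A_{ij}$ for every $(i,j)$ with $A_{ij}\in\{-1,1\}$. Sign complex. For each row $r$ of $A$, let $\sigma_r^+=\{i^+: r_i=+1\}\cup\{i^-: r_i=-1\}$ and $\sigma_r^-=\{i^-: r_i=+1\}\cup\{i^+: r_i=-1\}$, where $i^+,i^-$ are two disjoint copies of the column index $i$. The sign complex $S(A)$ is the abstract simplicial complex whose simplices are all subsets of $\sigma_r^+$ or $\sigma_r^-$ over all rows $r$. The involution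 $i^+\leftrightarrow i^-$ is a free simplicial $\mathbb{Z}_2$-action on $S(A)$, inducing a free action on the geometric realization $|S(A)|$. Index. For a free $\mathbb{Z}_2$-complex $K$, $\operatorname{ind}_{\mathbb{Z}_2}(K)$ is the minimum $d\ge 0$ for which there is a continuous $\mathbb{Z}_2$-equivariant map $|K|\to\mathbb{S}^d$, where $\mathbb{S}^d$ carries the antipodal action. *)

theory Defs
  imports
    "HOL-Analysis.Analysis"
    "HOL-Probability.Probability"
    "HOL-Library.Extended_Nat"
    "HOL-Algebra.Ring"
    "HOL-Number_Theory.Prime_Powers"
begin

text \<open>
  The points and lines of the plane over \<open>F\<close> are the subspaces of \<open>F\<^sup>3\<close> of
  dimension 1 and 2, and incidence is inclusion.
\<close>

type_synonym 'a vec3 = "'a \<times> 'a \<times> 'a"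

definition space3 :: "'a ring \<Rightarrow> 'a vec3 set" where
  "space3 F = carrier F \<times> carrier F \<times> carrier F"

definition zero3 :: "'a ring \<Rightarrow> 'a vec3" where
  "zero3 F = (\<zero>\<^bsub>F\<^esub>, \<zero>\<^bsub>F\<^esub>, \<zero>\<^bsub>F\<^esub>)"

fun add3 :: "'a ring \<Rightarrow> 'a vec3 \<Rightarrow> 'a vec3 \<Rightarrow> 'a vec3" where
  "add3 F (x1, x2, x3) (y1, y2, y3) = (x1 \<oplus>\<^bsub>F\<^esub> y1, x2 \<oplus>\<^bsub>F\<^esub> y2, x3 \<oplus>\<^bsub>F\<^esub> y3)"

fun scale3 :: "'a ring \<Rightarrow> 'a \<Rightarrow> 'a vec3 \<Rightarrow> 'a vec3" where
  "scale3 F a (x1, x2, x3) = (a \<otimes>\<^bsub>F\<^esub> x1, a \<otimes>\<^bsub>F\<^esub> x2, a \<otimes>\<^bsub>F\<^esub> x3)"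

definition indep3 :: "'a ring \<Rightarrow> 'a vec3 \<Rightarrow> 'a vec3 \<Rightarrow> bool" where
  "indep3 F v w \<longleftrightarrow>
     (\<forall>a\<in>carrier F. \<forall>b\<in>carrier F.
        add3 F (scale3 F a v) (scale3 F b w) = zero3 F \<longrightarrow> a = \<zero>\<^bsub>F\<^esub> \<and> b = \<zero>\<^bsub>F\<^esub>)"

definition span1 :: "'a ring \<Rightarrow> 'a vec3 \<Rightarrow> 'a vec3 set" where
  "span1 F v = {scale3 F a v | a. a \<in> carrier F}"

definition span2 :: "'a ring \<Rightarrow> 'a vec3 \<Rightarrow> 'a vec3 \<Rightarrow> 'a vec3 set" where
  "span2 F v w = {add3 F (scale3 F a v) (scale3 F b w) | a b. a \<in> carrier F \<and> b \<in> carrier F}"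

definition pg_points :: "'a ring \<Rightarrow> 'a vec3 set set" where
  "pg_points F = {span1 F v | v. v \<in> space3 F \<and> v \<noteq> zero3 F}"

definition pg_lines :: "'a ring \<Rightarrow> 'a vec3 set set" where
  "pg_lines F = {span2 F v w | v w. v \<in> space3 F \<and> w \<in> space3 F \<and> indep3 F v w}"

definition pg_flags :: "'a ring \<Rightarrow> ('a vec3 set \<times> 'a vec3 set) set" where
  "pg_flags F = {(l, p). l \<in> pg_lines F \<and> p \<in> pg_points F \<and> p \<subseteq> l}"

text \<open>
  A partial sign matrix is a function \<open>'r \<Rightarrow> 'c \<Rightarrow> entry\<close> together with explicit sets
  \<open>R\<close> of rows and \<open>C\<close> of columns; values outside \<open>R \<times> C\<close> are irrelevant.
  \<open>Plus\<close>, \<open>Minus\<close>, \<open>Star\<close> stand for \<open>1\<close>, \<open>-1\<close>, \<open>*\<close>.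
\<close>

datatype entry = Plus | Minus | Star

text \<open>Vectors of dimension \<open>d\<close> are functions on \<open>nat\<close> of which only the values below \<open>d\<close> matter.\<close>

definition sign_realizable ::
  "'r set \<Rightarrow> 'c set \<Rightarrow> ('r \<Rightarrow> 'c \<Rightarrow> entry) \<Rightarrow> nat \<Rightarrow> bool" where
  "sign_realizable R C A d \<longleftrightarrow>
     (\<exists>(u :: 'r \<Rightarrow> nat \<Rightarrow> real) (v :: 'c \<Rightarrow> nat \<Rightarrow> real).
        (\<forall>r\<in>R. \<exists>i<d. u r i \<noteq> 0) \<and>
        (\<forall>c\<in>C. \<exists>i<d. v c i \<noteq> 0) \<and>
        (\<forall>r\<in>R. \<forall>c\<in>C.
           (A r c = Plus \<longrightarrow> sgn (\<Sum>i<d. u r i * v c i) = 1) \<and>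
           (A r c = Minus \<longrightarrow> sgn (\<Sum>i<d. u r i * v c i) = -1)))"

definition sign_rank :: "'r set \<Rightarrow> 'c set \<Rightarrow> ('r \<Rightarrow> 'c \<Rightarrow> entry) \<Rightarrow> nat" where
  "sign_rank R C A = (LEAST d. sign_realizable R C A d)"

text \<open>For finitely many columns the minimum is taken over a nonempty set.\<close>

lemma sign_realizable_card:
  fixes R :: "'r set" and C :: "'c set"
  assumes "finite C" and "C \<noteq> {}"
  shows "sign_realizable R C A (card C)"
proof -
  obtain h where h: "bij_betw h {..<card C} C"
    using ex_bij_betw_nat_finite[OF assms(1)] by (auto simp: atLeast0LessThan)
  define g where "g = inv_into {..<card C} h"
  have g: "g c < card C" "h (g c) = c" if "c \<in> C" for c
    using h that bij_betw_inv_into_right[OF h that] bij_betwE[OF bij_betw_inv_into[OF h]]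
    by (auto simp: g_def)
  define u :: "'r \<Rightarrow> nat \<Rightarrow> real"
    where "u = (\<lambda>r i. if A r (h i) = Minus then -1 else 1)"
  define v :: "'c \<Rightarrow> nat \<Rightarrow> real" where "v = (\<lambda>c i. if i = g c then 1 else 0)"
  have uv: "(\<Sum>i<card C. u r i * v c i) = (if A r c = Minus then -1 else 1)" if "c \<in> C" for r c
  proof -
    have "(\<Sum>i<card C. u r i * v c i) = (\<Sum>i<card C. if i = g c then u r i else 0)"
      by (rule sum.cong) (simp_all add: v_def)
    also have "\<dots> = u r (g c)"
      using g(1)[OF that] by simp
    finally show ?thesis
      using g(2)[OF that] by (simp add: u_def)
  qed
  have "\<exists>i<card C. u r i \<noteq> 0" for r
    using assms by (intro exI[of _ 0]) (simp add: u_def card_gt_0_iff)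
  moreover have "\<exists>i<card C. v c i \<noteq> 0" if "c \<in> C" for c
    using g(1)[OF that] by (intro exI[of _ "g c"]) (simp add: v_def)
  ultimately show ?thesis
    unfolding sign_realizable_def using uv
    by (intro exI[of _ u] exI[of _ v]) simp
qed

text \<open>The vertices \<open>(c, True)\<close> and \<open>(c, False)\<close> are the two copies of the column \<open>c\<close>.\<close>

definition pos_facet :: "'c set \<Rightarrow> ('r \<Rightarrow> 'c \<Rightarrow> entry) \<Rightarrow> 'r \<Rightarrow> ('c \<times> bool) set" where
  "pos_facet C A r = {(c, True) | c. c \<in> C \<and> A r c = Plus} \<union> {(c, False) | c. c \<in> C \<and> A r c = Minus}"

definition neg_facet :: "'c set \<Rightarrow> ('r \<Rightarrow> 'c \<Rightarrow> entry) \<Rightarrow> 'r \<Rightarrow> ('c \<times> bool) set" where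
  "neg_facet C A r = {(c, False) | c. c \<in> C \<and> A r c = Plus} \<union> {(c, True) | c. c \<in> C \<and> A r c = Minus}"

definition sign_complex :: "'r set \<Rightarrow> 'c set \<Rightarrow> ('r \<Rightarrow> 'c \<Rightarrow> entry) \<Rightarrow> ('c \<times> bool) set set" where
  "sign_complex R C A = {s. \<exists>r\<in>R. s \<subseteq> pos_facet C A r \<or> s \<subseteq> neg_facet C A r}"

definition flip :: "'c \<times> bool \<Rightarrow> 'c \<times> bool" where
  "flip x = (fst x, \<not> snd x)"

text \<open>
  Points of the realization are given by their barycentric coordinates. The topology is that
  of pointwise convergence of coordinates, which for a finite complex is the usual one.
\<close>

definition realization :: "'v set set \<Rightarrow> ('v \<Rightarrow> real) set" where
  "realization K =
     {x. (\<forall>v. 0 \<le> x v) \<and> finite {v. x v \<noteq> 0} \<and> {v. x v \<noteq> 0} \<in> K \<and> (\<Sum>v | x v \<noteq> 0. x v) = 1}"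

definition realization_top :: "'v set set \<Rightarrow> ('v \<Rightarrow> real) topology" where
  "realization_top K = subtopology (powertop_real UNIV) (realization K)"

text \<open>
  A simplicial involution \<open>\<nu>\<close> acts on the realization by \<open>x \<mapsto> x \<circ> \<nu>\<close>. The index is
  \<open>\<infinity>\<close> if there is no equivariant map to any sphere.
\<close>

definition Z2_index :: "'v set set \<Rightarrow> ('v \<Rightarrow> 'v) \<Rightarrow> enat" where
  "Z2_index K \<nu> =
     Inf {enat d | d. \<exists>f. continuous_map (realization_top K) (nsphere d) f \<and>
                          (\<forall>x\<in>realization K. f (x \<circ> \<nu>) = (\<lambda>i. - f x i))}"

text \<open>
  The matrix is sampled as a function on pairs (line, point): independent uniform signs on
  the flags, and the default value \<open>Star\<close> elsewhere.
\<close>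

definition random_pg_matrix ::
  "'a ring \<Rightarrow> ('a vec3 set \<Rightarrow> 'a vec3 set \<Rightarrow> entry) pmf" where
  "random_pg_matrix F =
     map_pmf curry (Pi_pmf (pg_flags F) Star (\<lambda>_. pmf_of_set {Plus, Minus}))"

end

theory Submission
  imports Defs "Jordan_Normal_Form.Determinant"
begin

text \<open>
  \<^bold>\<open>The index.\<close> Two lines of the plane share only one point, so two facets of the sign complex share
  at most one vertex. Up to equivariant homotopy the complex is therefore a graph with a free
  involution, and such a graph maps to the circle. An explicit map is given by a linear and a quadratic
  form in the barycentric coordinates (\<open>Z2_index_sign_complex_le_1\<close>).

  \<^bold>\<open>The sign-rank.\<close> This is a counting argument. A matrix of sign-rank at most \<open>d\<close> is the sign pattern
  of \<open>m\<close> quadratic forms, one for each flag, at a point of \<open>\<real>\<^sup>n\<close>, where \<open>n\<close> is \<open>d\<close> times the number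
  of lines and points. Every line and every point lies in at least \<open>q + 1\<close> flags, so \<open>m \<ge> 40 n\<close> as soon
  as \<open>80 d \<le> q + 1\<close>. It remains to see that in this range the number of sign patterns is much smaller
  than \<open>2\<^sup>m\<close>, the number of all sign matrices. A bound by a power of \<open>m ^ n\<close>
  would lose a logarithm; the number has to be exponential in a small multiple of \<open>m\<close>, as in
  Warren's theorem.

  Instead of the topology of real varieties, which underlies Warren's theorem, the count uses
  linear algebra (\<open>card_sign_patterns_le\<close>). Let \<open>H\<close> be the set of sign patterns attained by
  polynomials \<open>f\<^sub>e\<close>, the pattern \<open>h\<close> at the point \<open>x\<^sub>h\<close>, and let \<open>r\<close> be the number of monomials that
  may occur in a product of some of the \<open>f\<^sub>e\<close>. The matrix with the entries \<open>\<Prod>e\<in>S. f\<^sub>e(x\<^sub>h)\<close>, for sets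
  \<open>S\<close> of indices and patterns \<open>h\<close>, factors through \<open>\<real>\<^sup>r\<close>. Its signs are those of the matrix of
  characters of the cube, which has orthogonal columns. By Forster's theorem on the sign-rank of such
  matrices (\<open>card_le_of_orthogonal_signs\<close>), \<open>card H \<le> 9 r\<^sup>2\<close>. For quadratic forms and \<open>m \<ge> 40 n\<close>,
  the number \<open>r\<close> of monomials of degree at most \<open>2 m\<close> in \<open>n\<close> variables satisfies \<open>r\<^sup>4 \<le> 2\<^sup>m\<close>
  (\<open>card_exponents_power_le\<close>), so at most 9 times the square root of \<open>2\<^sup>m\<close> matrices are bad.

  Forster's theorem rests on moving a family of vectors into a position where, after normalization,
  it is spread evenly over all directions. An approximate version is enough, and it follows from the
  boundedness of a potential (\<open>near_isotropic_position\<close>).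
\<close>

unbundle no vec_syntax
hide_const (open) Determinants.det

section \<open>Near-isotropic position\<close>

text \<open>
  The matrix with rows \<open>(1, - y\<^sup>T)\<close> and \<open>(x, I)\<close> has two factorizations into block triangular
  matrices: one shows the left-hand side as its determinant, the other one the right-hand side.
\<close>

lemma det_identity_plus_rank_one:
  fixes x y :: "nat \<Rightarrow> real"
  shows "det (1\<^sub>m n + mat n n (\<lambda>(i, j). x i * y j)) = 1 + (\<Sum>i<n. x i * y i)"
proof -
  let ?C = "mat n 1 (\<lambda>(i, j). x i)" and ?R = "mat 1 n (\<lambda>(i, j). - y j)"
  let ?s = "\<Sum>i<n. x i * y i"
  let ?S = "mat 1 1 (\<lambda>_. 1 + ?s)" and ?M = "1\<^sub>m n + mat n n (\<lambda>(i, j). x i * y j)"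
  have 1: "four_block_mat (1\<^sub>m 1) (0\<^sub>m 1 n) ?C (1\<^sub>m n) * four_block_mat (1\<^sub>m 1) ?R (0\<^sub>m n 1) ?M
      = four_block_mat (1\<^sub>m 1) ?R ?C (1\<^sub>m n)"
    by (subst mult_four_block_mat[where ?nr1.0 = 1 and ?n1.0 = 1 and ?n2.0 = n and ?nr2.0 = n
          and ?nc1.0 = 1 and ?nc2.0 = n])
      (auto intro!: arg_cong4[where f = four_block_mat] eq_matI simp: scalar_prod_def)
  have 2: "four_block_mat ?S ?R (0\<^sub>m n 1) (1\<^sub>m n) * four_block_mat (1\<^sub>m 1) (0\<^sub>m 1 n) ?C (1\<^sub>m n)
      = four_block_mat (1\<^sub>m 1) ?R ?C (1\<^sub>m n)"
    by (subst mult_four_block_mat[where ?nr1.0 = 1 and ?n1.0 = 1 and ?n2.0 = n and ?nr2.0 = n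
          and ?nc1.0 = 1 and ?nc2.0 = n])
      (auto intro!: arg_cong4[where f = four_block_mat] eq_matI
        simp: scalar_prod_def lessThan_atLeast0 sum_negf mult.commute)
  have c: "four_block_mat (1\<^sub>m 1) (0\<^sub>m 1 n) ?C (1\<^sub>m n) \<in> carrier_mat (1 + n) (1 + n)"
      "four_block_mat (1\<^sub>m 1) ?R (0\<^sub>m n 1) ?M \<in> carrier_mat (1 + n) (1 + n)"
      "four_block_mat ?S ?R (0\<^sub>m n 1) (1\<^sub>m n) \<in> carrier_mat (1 + n) (1 + n)"
    by (rule four_block_carrier_mat; simp)+
  have L: "det (four_block_mat (1\<^sub>m 1) (0\<^sub>m 1 n) ?C (1\<^sub>m n)) = 1"
    by (subst det_four_block_mat_upper_right_zero[where n = 1 and m = n]) auto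
  have M: "det (four_block_mat (1\<^sub>m 1) ?R (0\<^sub>m n 1) ?M) = det ?M"
    by (subst det_four_block_mat_lower_left_zero[where n = 1 and m = n]) auto
  have S: "det (four_block_mat ?S ?R (0\<^sub>m n 1) (1\<^sub>m n)) = 1 + ?s"
    by (subst det_four_block_mat_lower_left_zero[where n = 1 and m = n]) (auto simp: det_single)
  have "det ?M = det (four_block_mat (1\<^sub>m 1) (0\<^sub>m 1 n) ?C (1\<^sub>m n) * four_block_mat (1\<^sub>m 1) ?R (0\<^sub>m n 1) ?M)"
    using det_mult[OF c(1,2)] L M by simp
  also have "\<dots> = 1 + ?s"
    unfolding 1 2[symmetric] using det_mult[OF c(3,1)] L S by simp
  finally show ?thesis .
qed

text \<open>
  Hadamard's inequality, weakened by the factor \<open>(fact n)\<^sup>2\<close>. In this form it follows at once from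
  the Leibniz formula, each entry being at most the norm of its row. It serves to bound a potential
  from below, and any constant will do for that.
\<close>

lemma det_square_le:
  fixes X :: "real mat"
  assumes "X \<in> carrier_mat n n"
  shows "(det X)\<^sup>2 \<le> (fact n)\<^sup>2 * (\<Prod>i<n. \<Sum>j<n. (X $$ (i, j))\<^sup>2)"
proof -
  let ?N = "\<lambda>i. \<Sum>j<n. (X $$ (i, j))\<^sup>2"
  have "\<bar>det X\<bar> \<le> (\<Sum>p\<in>{p. p permutes {0..<n}}. \<bar>signof p * (\<Prod>i = 0..<n. X $$ (i, p i))\<bar>)"
    unfolding det_def'[OF assms] by (rule sum_abs)
  also have "\<dots> \<le> (\<Sum>p\<in>{p. p permutes {0..<n}}. \<Prod>i<n. sqrt (?N i))"
  proof (rule sum_mono)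
    fix p assume "p \<in> {p. p permutes {0..<n}}"
    then have p: "p i < n" if "i < n" for i
      using that permutes_in_image[of p "{0..<n}" i] by auto
    have "\<bar>signof p * (\<Prod>i = 0..<n. X $$ (i, p i))\<bar> = (\<Prod>i<n. \<bar>X $$ (i, p i)\<bar>)"
      by (simp add: abs_mult abs_prod sign_def lessThan_atLeast0)
    also have "\<dots> \<le> (\<Prod>i<n. sqrt (?N i))"
    proof (rule prod_mono, safe)
      fix i assume "i < n"
      have "(X $$ (i, p i))\<^sup>2 \<le> ?N i"
        using p[OF \<open>i < n\<close>] by (intro member_le_sum) auto
      then show "\<bar>X $$ (i, p i)\<bar> \<le> sqrt (?N i)"
        using real_le_rsqrt by fastforce
    qed auto
    finally show "\<bar>signof p * (\<Prod>i = 0..<n. X $$ (i, p i))\<bar> \<le> (\<Prod>i<n. sqrt (?N i))" .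
  qed
  also have "\<dots> = fact n * (\<Prod>i<n. sqrt (?N i))"
    by (simp add: card_permutations)
  finally have "\<bar>det X\<bar>\<^sup>2 \<le> (fact n * (\<Prod>i<n. sqrt (?N i)))\<^sup>2"
    by (rule power_mono) auto
  also have "\<dots> = (fact n)\<^sup>2 * (\<Prod>i<n. ?N i)"
    by (simp add: power_mult_distrib prod_power_distrib sum_nonneg)
  finally show ?thesis by simp
qed

definition normsq :: "nat \<Rightarrow> (nat \<Rightarrow> real) \<Rightarrow> real" where
  "normsq n x = (\<Sum>j<n. (x j)\<^sup>2)"

definition vec_mat :: "nat \<Rightarrow> (nat \<Rightarrow> real) \<Rightarrow> real mat \<Rightarrow> nat \<Rightarrow> real" where
  "vec_mat n a P j = (\<Sum>i<n. a i * P $$ (i, j))"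

lemma normsq_nonneg: "0 \<le> normsq n x"
  by (simp add: normsq_def sum_nonneg)

text \<open>
  The argument of the norm on the left is \<open>x\<close>, stretched by the factor 2 in the direction of \<open>w\<close>.
  The component of \<open>x\<close> along \<open>w\<close> has squared norm \<open>t\<^sup>2 / normsq n w\<close>, which is multiplied by 4.
\<close>

lemma normsq_add_scaled:
  fixes x w :: "nat \<Rightarrow> real"
  assumes "normsq n w \<noteq> 0"
  defines "t \<equiv> \<Sum>j<n. x j * w j"
  shows "normsq n (\<lambda>j. x j + t / normsq n w * w j) = normsq n x + 3 * t\<^sup>2 / normsq n w"
proof -
  define s where "s = t / normsq n w"
  have "normsq n (\<lambda>j. x j + s * w j) = (\<Sum>j<n. (x j)\<^sup>2 + 2 * s * (x j * w j) + s\<^sup>2 * (w j)\<^sup>2)"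
    unfolding normsq_def by (intro sum.cong) (auto simp: power2_eq_square algebra_simps)
  also have "\<dots> = normsq n x + 2 * s * t + s\<^sup>2 * normsq n w"
    by (simp add: sum.distrib normsq_def t_def sum_distrib_left)
  also have "\<dots> = normsq n x + 3 * t\<^sup>2 / normsq n w"
    using assms(1) by (simp add: s_def power2_eq_square field_simps)
  finally show ?thesis by (simp add: s_def)
qed

text \<open>
  The vectors \<open>a g m\<close> with \<open>m < n\<close> form a basis for every \<open>g\<close>. After a suitable change of
  coordinates \<open>P\<close> and normalization, the \<open>card G * n\<close> vectors obtained give each direction at
  least a third of its fair share. The change of coordinates comes from the potential
  \<open>\<Phi> P = (\<Sum>g\<in>G. \<Sum>m<n. ln (normsq n (vec_mat n (a g m) P))) - card G * ln ((det P)\<^sup>2)\<close>.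
  It is bounded below, because in each basis the product of the norms controls the determinant.
  Take \<open>P\<close> close to its infimum. If the vectors had too small a component along \<open>w\<close>, stretching by
  the factor 2 along \<open>w\<close> would multiply the determinant by 2 and so gain \<open>ln 4\<close> for each \<open>g\<close>,
  while the sum of the logarithms would grow by less than 1 for each \<open>g\<close>, and \<open>1 < ln 4\<close>. A minimum
  need not exist, and near-minimality suffices.
\<close>

lemma near_isotropic_position:
  fixes a :: "'g \<Rightarrow> nat \<Rightarrow> nat \<Rightarrow> real"
  assumes G: "finite G" "G \<noteq> {}"
  assumes basis: "\<And>g. g \<in> G \<Longrightarrow> det (mat n n (\<lambda>(m, i). a g m i)) \<noteq> 0"
  obtains P where "P \<in> carrier_mat n n" "det P \<noteq> 0"
    "\<And>g m. g \<in> G \<Longrightarrow> m < n \<Longrightarrow> 0 < normsq n (vec_mat n (a g m) P)"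
    "\<And>w. real (card G) / 3 * normsq n w \<le>
       (\<Sum>g\<in>G. \<Sum>m<n. (\<Sum>j<n. vec_mat n (a g m) P j * w j)\<^sup>2 / normsq n (vec_mat n (a g m) P))"
proof -
  define A where "A g = mat n n (\<lambda>(m, i). a g m i)" for g
  define \<P> :: "real mat set" where "\<P> = {P \<in> carrier_mat n n. det P \<noteq> 0}"
  define N where "N g m P = normsq n (vec_mat n (a g m) P)" for g m P
  define \<Phi> where "\<Phi> P = (\<Sum>g\<in>G. \<Sum>m<n. ln (N g m P)) - card G * ln ((det P)\<^sup>2)" for P
  have A: "A g \<in> carrier_mat n n" for g
    by (simp add: A_def)
  have hadamard: "(det (A g))\<^sup>2 * (det P)\<^sup>2 \<le> (fact n)\<^sup>2 * (\<Prod>m<n. N g m P)"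
    if "P \<in> \<P>" for g P
  proof -
    have P: "P \<in> carrier_mat n n"
      using that by (simp add: \<P>_def)
    have "(det (A g * P))\<^sup>2 \<le> (fact n)\<^sup>2 * (\<Prod>i<n. \<Sum>j<n. ((A g * P) $$ (i, j))\<^sup>2)"
      by (rule det_square_le[OF mult_carrier_mat[OF A P]])
    also have "(\<Prod>i<n. \<Sum>j<n. ((A g * P) $$ (i, j))\<^sup>2) = (\<Prod>m<n. N g m P)"
      unfolding N_def normsq_def vec_mat_def using P
      by (intro prod.cong sum.cong refl) (auto simp: A_def scalar_prod_def lessThan_atLeast0)
    finally show ?thesis
      using det_mult[OF A P] by (simp add: power_mult_distrib)
  qed
  have Npos: "0 < N g m P" if "P \<in> \<P>" "g \<in> G" "m < n" for g m P
  proof -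
    have "0 < (det (A g))\<^sup>2 * (det P)\<^sup>2"
      using that basis by (simp add: \<P>_def A_def)
    also have "\<dots> \<le> (fact n)\<^sup>2 * (\<Prod>m<n. N g m P)"
      by (rule hadamard[OF that(1)])
    finally have "(\<Prod>m<n. N g m P) \<noteq> 0" by (metis less_irrefl mult_zero_right)
    then have "N g m P \<noteq> 0" using that by auto
    then show ?thesis using normsq_nonneg[of n "vec_mat n (a g m) P"] by (simp add: N_def)
  qed
  define L where "L = (\<Sum>g\<in>G. ln ((det (A g))\<^sup>2 / (fact n)\<^sup>2))"
  have lower: "L \<le> \<Phi> P" if "P \<in> \<P>" for P
  proof -
    have "ln ((det (A g))\<^sup>2 / (fact n)\<^sup>2) + ln ((det P)\<^sup>2) \<le> (\<Sum>m<n. ln (N g m P))" if g: "g \<in> G" for g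
    proof -
      have dA: "det (A g) \<noteq> 0" using basis[OF g] by (simp add: A_def)
      have dP: "det P \<noteq> 0" using \<open>P \<in> \<P>\<close> by (simp add: \<P>_def)
      have pr: "0 < (\<Prod>m<n. N g m P)"
        using Npos[OF \<open>P \<in> \<P>\<close> g] by (intro prod_pos) auto
      have "ln ((det (A g))\<^sup>2 / (fact n)\<^sup>2) + ln ((det P)\<^sup>2) = ln ((det (A g))\<^sup>2 / (fact n)\<^sup>2 * (det P)\<^sup>2)"
        using dA dP by (subst ln_mult) auto
      also have "\<dots> \<le> ln (\<Prod>m<n. N g m P)"
        using hadamard[OF \<open>P \<in> \<P>\<close>, of g] dA dP pr
        by (subst ln_le_cancel_iff) (auto simp: field_simps)
      also have "\<dots> = (\<Sum>m<n. ln (N g m P))"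
        using less_imp_neq[OF Npos[OF \<open>P \<in> \<P>\<close> g], symmetric] by (intro ln_prod) auto
      finally show ?thesis .
    qed
    then have "(\<Sum>g\<in>G. ln ((det (A g))\<^sup>2 / (fact n)\<^sup>2) + ln ((det P)\<^sup>2)) \<le> (\<Sum>g\<in>G. \<Sum>m<n. ln (N g m P))"
      by (rule sum_mono)
    then show ?thesis
      by (simp add: L_def \<Phi>_def sum.distrib)
  qed
  have one: "1\<^sub>m n \<in> \<P>" by (simp add: \<P>_def)
  have bdd: "bdd_below (\<Phi> ` \<P>)" using lower by (intro bdd_belowI[of _ L]) auto
  have cG: "0 < real (card G)" using G by (simp add: card_gt_0_iff)
  have ln4: "1 < ln (4::real)"
  proof -
    have "ln (4::real) = 2 * ln 2"
      using ln_realpow[of 2 2] by simp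
    then show ?thesis using ln2_ge_two_thirds by simp
  qed
  have "Inf (\<Phi> ` \<P>) < Inf (\<Phi> ` \<P>) + card G * (ln 4 - 1)"
    using cG ln4 by simp
  then obtain P where P: "P \<in> \<P>" and near: "\<Phi> P < Inf (\<Phi> ` \<P>) + card G * (ln 4 - 1)"
    using cInf_lessD[of "\<Phi> ` \<P>"] one by blast
  have P': "P \<in> carrier_mat n n" "det P \<noteq> 0" using P by (auto simp: \<P>_def)
  have iso: "real (card G) / 3 * normsq n w \<le>
       (\<Sum>g\<in>G. \<Sum>m<n. (\<Sum>j<n. vec_mat n (a g m) P j * w j)\<^sup>2 / N g m P)" (is "_ \<le> ?T") for w
  proof (rule ccontr)
    assume "\<not> ?thesis"
    then have less: "?T < card G / 3 * normsq n w" by simp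
    have "0 \<le> ?T" by (intro sum_nonneg divide_nonneg_nonneg) (auto simp: N_def normsq_nonneg)
    with less have "normsq n w \<noteq> 0" by auto
    then have W: "0 < normsq n w" using normsq_nonneg[of n w] by simp
    \<comment> \<open>The linear map that doubles \<open>w\<close> and fixes its orthogonal complement.\<close>
    define C where "C = 1\<^sub>m n + mat n n (\<lambda>(i, j). w i * (w j / normsq n w))"
    have C: "C \<in> carrier_mat n n" by (simp add: C_def)
    have "det C = 1 + (\<Sum>i<n. w i * (w i / normsq n w))"
      unfolding C_def by (rule det_identity_plus_rank_one)
    also have "(\<Sum>i<n. w i * (w i / normsq n w)) = normsq n w / normsq n w"
      unfolding normsq_def sum_divide_distrib by (intro sum.cong) (auto simp: power2_eq_square)
    finally have detC: "det C = 2" using W by simp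
    have PC: "P * C \<in> \<P>"
      using P' C detC det_mult[OF P'(1) C] by (auto simp: \<P>_def)
    define t where "t g m = (\<Sum>j<n. vec_mat n (a g m) P j * w j)" for g m
    have stretch: "vec_mat n x (P * C) j = vec_mat n x P j + (\<Sum>j<n. vec_mat n x P j * w j) / normsq n w * w j"
      if "j < n" for x j
    proof -
      have e: "(P * C) $$ (i, j) = P $$ (i, j) + (\<Sum>k<n. P $$ (i, k) * w k) / normsq n w * w j" if "i < n" for i
      proof -
        have "(P * C) $$ (i, j) = (\<Sum>k<n. P $$ (i, k) * C $$ (k, j))"
          using P' C that \<open>j < n\<close> by (auto simp: scalar_prod_def lessThan_atLeast0)
        also have "\<dots> = (\<Sum>k<n. (if k = j then P $$ (i, k) else 0) + P $$ (i, k) * w k * (w j / normsq n w))"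
          using \<open>j < n\<close> by (intro sum.cong) (auto simp: C_def algebra_simps)
        also have "\<dots> = (\<Sum>k<n. if k = j then P $$ (i, k) else 0) + (\<Sum>k<n. P $$ (i, k) * w k) * (w j / normsq n w)"
          by (simp only: sum.distrib sum_distrib_right)
        also have "\<dots> = P $$ (i, j) + (\<Sum>k<n. P $$ (i, k) * w k) / normsq n w * w j"
          using \<open>j < n\<close> by simp
        finally show ?thesis .
      qed
      have "vec_mat n x (P * C) j = (\<Sum>i<n. x i * P $$ (i, j) + (\<Sum>k<n. x i * P $$ (i, k) * w k) * (w j / normsq n w))"
        unfolding vec_mat_def
        by (intro sum.cong) (auto simp: e algebra_simps sum_distrib_left sum_divide_distrib)
      also have "\<dots> = vec_mat n x P j + (\<Sum>i<n. \<Sum>k<n. x i * P $$ (i, k) * w k) * (w j / normsq n w)"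
        by (simp only: sum.distrib sum_distrib_right vec_mat_def)
      also have "(\<Sum>i<n. \<Sum>k<n. x i * P $$ (i, k) * w k) = (\<Sum>k<n. vec_mat n x P k * w k)"
        unfolding vec_mat_def sum_distrib_right by (rule sum.swap)
      finally show ?thesis by simp
    qed
    have NC: "N g m (P * C) = N g m P + 3 * (t g m)\<^sup>2 / normsq n w" for g m
    proof -
      have "N g m (P * C) = normsq n (\<lambda>j. vec_mat n (a g m) P j + t g m / normsq n w * w j)"
        unfolding N_def t_def normsq_def by (intro sum.cong) (auto simp: stretch[unfolded normsq_def])
      then show ?thesis
        using normsq_add_scaled[of n w "vec_mat n (a g m) P"] W by (simp add: t_def N_def)
    qed
    have "ln (N g m (P * C)) \<le> ln (N g m P) + 3 / normsq n w * ((t g m)\<^sup>2 / N g m P)"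
      if "g \<in> G" "m < n" for g m
    proof -
      have N: "0 < N g m P" by (rule Npos[OF P that])
      have "ln (N g m (P * C)) = ln (N g m P * (1 + 3 / normsq n w * ((t g m)\<^sup>2 / N g m P)))"
        unfolding NC using N W by (intro arg_cong[where f = ln]) (simp add: field_simps)
      also have "\<dots> = ln (N g m P) + ln (1 + 3 / normsq n w * ((t g m)\<^sup>2 / N g m P))"
      proof (rule ln_mult_pos)
        show "0 < 1 + 3 / normsq n w * ((t g m)\<^sup>2 / N g m P)"
          using N W by (intro add_pos_nonneg mult_nonneg_nonneg divide_nonneg_nonneg) auto
      qed (rule N)
      also have "\<dots> \<le> ln (N g m P) + 3 / normsq n w * ((t g m)\<^sup>2 / N g m P)"
        using N W by (intro add_left_mono ln_add_one_self_le_self) auto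
      finally show ?thesis .
    qed
    then have "(\<Sum>g\<in>G. \<Sum>m<n. ln (N g m (P * C))) \<le>
        (\<Sum>g\<in>G. \<Sum>m<n. ln (N g m P) + 3 / normsq n w * ((t g m)\<^sup>2 / N g m P))"
      by (intro sum_mono) auto
    also have "\<dots> = (\<Sum>g\<in>G. \<Sum>m<n. ln (N g m P)) + 3 / normsq n w * ?T"
      by (simp add: sum.distrib sum_distrib_left t_def)
    also have "3 / normsq n w * ?T < card G"
      using less W by (simp add: field_simps)
    finally have "\<Phi> (P * C) < \<Phi> P + card G - card G * ln 4"
      using det_mult[OF P'(1) C] P' by (simp add: \<Phi>_def detC power_mult_distrib ln_mult algebra_simps)
    moreover have "Inf (\<Phi> ` \<P>) \<le> \<Phi> (P * C)"
      using PC bdd by (intro cInf_lower) auto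
    ultimately show False
      using near by (simp add: algebra_simps)
  qed
  show thesis
    by (rule that[OF P']) (use Npos[OF P] iso in \<open>simp_all add: N_def\<close>)
qed

section \<open>Forster's bound for orthogonal sign vectors\<close>

text \<open>
  This is Forster's lower bound on the sign-rank, for a sign matrix with orthogonal columns and with a
  weaker constant. In near-isotropic position, each unit vector \<open>\<beta> h\<close> has
  \<open>(\<Sum>g\<in>G. \<Sum>m<n. (\<alpha> g m \<bullet> \<beta> h)\<^sup>2) \<ge> card G / 3\<close>; the absolute values of these inner products
  are at most 1, so their sum is at least as large as the sum of the squares. The absolute value of
  \<open>\<alpha> g m \<bullet> \<beta> h\<close> is \<open>\<chi> g h * (\<alpha> g m \<bullet> \<beta> h)\<close>, and orthogonality of the columns of \<open>\<chi>\<close> bounds the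
  sum of these terms over all \<open>g\<close>, \<open>m\<close> and \<open>h\<close> by \<open>card G * n * sqrt (card H)\<close>. Hence
  \<open>card H / 3 \<le> n * sqrt (card H)\<close>.

  The vectors \<open>u g\<close> themselves may lie in special position, where no change of coordinates makes them
  isotropic. Therefore each of them is replaced by the \<open>n\<close> vectors \<open>u g + \<delta> e\<^sub>m\<close>, which form a basis
  for generic \<open>\<delta>\<close> and keep the signs for small \<open>\<delta>\<close>.
\<close>

lemma card_le_of_orthogonal_signs:
  fixes u :: "'g \<Rightarrow> nat \<Rightarrow> real" and v :: "'h \<Rightarrow> nat \<Rightarrow> real" and \<chi> :: "'g \<Rightarrow> 'h \<Rightarrow> real"
  assumes G: "finite G" "G \<noteq> {}" and H: "finite H"
  assumes unit: "\<And>g h. g \<in> G \<Longrightarrow> h \<in> H \<Longrightarrow> \<bar>\<chi> g h\<bar> = 1"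
  assumes orth: "\<And>h h'. h \<in> H \<Longrightarrow> h' \<in> H \<Longrightarrow> h \<noteq> h' \<Longrightarrow> (\<Sum>g\<in>G. \<chi> g h * \<chi> g h') = 0"
  assumes sign: "\<And>g h. g \<in> G \<Longrightarrow> h \<in> H \<Longrightarrow> 0 < \<chi> g h * (\<Sum>i<n. u g i * v h i)"
  shows "real (card H) \<le> 9 * (real n)\<^sup>2"
proof (cases "H = {}")
  case False
  from G(2) False obtain g0 h0 where "g0 \<in> G" "h0 \<in> H" by auto
  then have n: "0 < n" using sign[of g0 h0] by (cases n) auto
  have "\<forall>\<^sub>F \<delta> in at_right (0::real). 0 < \<delta> \<and>
      (\<forall>g\<in>G. (\<forall>h\<in>H. \<forall>m\<in>{..<n}. 0 < \<chi> g h * ((\<Sum>i<n. u g i * v h i) + \<delta> * v h m)) \<and>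
        \<delta> + (\<Sum>i<n. u g i) \<noteq> 0)"
  proof (intro eventually_conj eventually_ball_finite ballI G H finite_lessThan)
    show "\<forall>\<^sub>F \<delta> in at_right (0::real). 0 < \<delta>" by (rule eventually_at_right_less)
  next
    fix g h m assume "g \<in> G" "h \<in> H"
    have "((\<lambda>\<delta>. \<chi> g h * ((\<Sum>i<n. u g i * v h i) + \<delta> * v h m)) \<longlongrightarrow>
        \<chi> g h * ((\<Sum>i<n. u g i * v h i) + 0 * v h m)) (at_right 0)"
      by (intro tendsto_intros)
    then show "\<forall>\<^sub>F \<delta> in at_right 0. 0 < \<chi> g h * ((\<Sum>i<n. u g i * v h i) + \<delta> * v h m)"
      by (rule order_tendstoD) (use sign[OF \<open>g \<in> G\<close> \<open>h \<in> H\<close>] in simp)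
  next
    fix g assume "g \<in> G"
    show "\<forall>\<^sub>F \<delta> in at_right 0. \<delta> + (\<Sum>i<n. u g i) \<noteq> 0"
    proof (cases "(\<Sum>i<n. u g i) = 0")
      case True
      show ?thesis unfolding True using eventually_at_right_less[of "0::real"] by eventually_elim simp
    next
      case False
      have "((\<lambda>\<delta>. \<delta> + (\<Sum>i<n. u g i)) \<longlongrightarrow> 0 + (\<Sum>i<n. u g i)) (at_right 0)"
        by (intro tendsto_intros)
      then show ?thesis
        by (rule tendsto_imp_eventually_ne) (use False in simp)
    qed
  qed
  from eventually_happens'[OF trivial_limit_at_right_real this] obtain \<delta> where \<delta>: "0 < \<delta>"
    and generic: "\<forall>g\<in>G. (\<forall>h\<in>H. \<forall>m\<in>{..<n}. 0 < \<chi> g h * ((\<Sum>i<n. u g i * v h i) + \<delta> * v h m)) \<and>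
        \<delta> + (\<Sum>i<n. u g i) \<noteq> 0"
    by (elim exE conjE)
  have sign': "0 < \<chi> g h * ((\<Sum>i<n. u g i * v h i) + \<delta> * v h m)" if "g \<in> G" "h \<in> H" "m < n" for g h m
    using generic that by (meson lessThan_iff)
  have nz: "\<delta> + (\<Sum>i<n. u g i) \<noteq> 0" if "g \<in> G" for g
    using generic that by meson
  define a where "a g m i = u g i + (if i = m then \<delta> else 0)" for g m i
  have basis: "det (mat n n (\<lambda>(m, i). a g m i)) \<noteq> 0" if "g \<in> G" for g
  proof -
    have "mat n n (\<lambda>(m, i). a g m i) = \<delta> \<cdot>\<^sub>m (1\<^sub>m n + mat n n (\<lambda>(m, i). 1 * (u g i / \<delta>)))"
      using \<delta> by (intro eq_matI) (auto simp: a_def field_simps)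
    then have "det (mat n n (\<lambda>(m, i). a g m i)) = \<delta> ^ n * (1 + (\<Sum>i<n. 1 * (u g i / \<delta>)))"
      by (simp only: det_smult det_identity_plus_rank_one) simp
    also have "1 + (\<Sum>i<n. 1 * (u g i / \<delta>)) = (\<delta> + (\<Sum>i<n. u g i)) / \<delta>"
      using \<delta> by (simp add: sum_divide_distrib add_divide_distrib)
    finally show ?thesis using nz[OF that] \<delta> by simp
  qed
  obtain P where P: "P \<in> carrier_mat n n" "det P \<noteq> 0"
    and Npos: "\<And>g m. g \<in> G \<Longrightarrow> m < n \<Longrightarrow> 0 < normsq n (vec_mat n (a g m) P)"
    and iso: "\<And>w. real (card G) / 3 * normsq n w \<le>
       (\<Sum>g\<in>G. \<Sum>m<n. (\<Sum>j<n. vec_mat n (a g m) P j * w j)\<^sup>2 / normsq n (vec_mat n (a g m) P))"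
    using near_isotropic_position[where a = a, OF G basis] by blast
  \<comment> \<open>The vectors \<open>v h\<close> transform contragrediently, so that all inner products are preserved.\<close>
  obtain Q where Q: "Q \<in> carrier_mat n n" "P * Q = 1\<^sub>m n"
    using det_non_zero_imp_unit[OF P] by (auto simp: Units_def ring_mat_def)
  define v' where "v' h j = (\<Sum>k<n. Q $$ (j, k) * v h k)" for h j
  define N where "N g m = normsq n (vec_mat n (a g m) P)" for g m
  define V where "V h = normsq n (v' h)" for h
  have dual: "(\<Sum>j<n. vec_mat n x P j * v' h j) = (\<Sum>i<n. x i * v h i)" for x h
  proof -
    have PQ: "(\<Sum>j<n. P $$ (i, j) * Q $$ (j, k)) = (if i = k then 1 else 0)" if "i < n" "k < n" for i k
    proof -
      have "(\<Sum>j<n. P $$ (i, j) * Q $$ (j, k)) = (P * Q) $$ (i, k)"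
        using P Q(1) that by (auto simp: scalar_prod_def lessThan_atLeast0)
      then show ?thesis using Q(2) that by simp
    qed
    have "(\<Sum>j<n. vec_mat n x P j * v' h j) = (\<Sum>j<n. \<Sum>i<n. \<Sum>k<n. x i * v h k * (P $$ (i, j) * Q $$ (j, k)))"
      by (simp add: vec_mat_def v'_def sum_product algebra_simps)
    also have "\<dots> = (\<Sum>i<n. \<Sum>j<n. \<Sum>k<n. x i * v h k * (P $$ (i, j) * Q $$ (j, k)))"
      by (rule sum.swap)
    also have "\<dots> = (\<Sum>i<n. \<Sum>k<n. \<Sum>j<n. x i * v h k * (P $$ (i, j) * Q $$ (j, k)))"
      by (intro sum.cong refl sum.swap)
    also have "\<dots> = (\<Sum>i<n. \<Sum>k<n. if i = k then x i * v h k else 0)"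
      by (intro sum.cong refl) (auto simp: sum_distrib_left[symmetric] PQ)
    finally show ?thesis by simp
  qed
  define t where "t g m h = (\<Sum>j<n. vec_mat n (a g m) P j * v' h j)" for g m h
  have sign_t: "0 < \<chi> g h * t g m h" if "g \<in> G" "h \<in> H" "m < n" for g m h
  proof -
    have "t g m h = (\<Sum>i<n. u g i * v h i + (if i = m then \<delta> * v h i else 0))"
      unfolding t_def dual a_def by (intro sum.cong) (auto simp: algebra_simps)
    also have "\<dots> = (\<Sum>i<n. u g i * v h i) + \<delta> * v h m"
      using that by (simp add: sum.distrib)
    finally show ?thesis using sign'[OF that] by simp
  qed
  have Vpos: "0 < V h" if "h \<in> H" for h
  proof -
    have "V h \<noteq> 0"
    proof
      assume "V h = 0"
      then have "v' h j = 0" if "j < n" for j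
        using that by (simp add: V_def normsq_def sum_nonneg_eq_0_iff)
      then have "t g0 0 h = 0" by (simp add: t_def)
      then show False using sign_t[OF \<open>g0 \<in> G\<close> that n] by simp
    qed
    then show ?thesis using normsq_nonneg[of n "v' h"] by (simp add: V_def)
  qed
  define \<alpha> where "\<alpha> g m j = vec_mat n (a g m) P j / sqrt (N g m)" for g m j
  define \<beta> where "\<beta> h j = v' h j / sqrt (V h)" for h j
  define s where "s g m h = (\<Sum>j<n. \<alpha> g m j * \<beta> h j)" for g m h
  have \<alpha>1: "(\<Sum>j<n. (\<alpha> g m j)\<^sup>2) = 1" if "g \<in> G" "m < n" for g m
    using Npos[OF that]
    by (simp add: \<alpha>_def power_divide sum_divide_distrib[symmetric] N_def normsq_def[symmetric])
  have \<beta>1: "(\<Sum>j<n. (\<beta> h j)\<^sup>2) = 1" if "h \<in> H" for h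
    using Vpos[OF that]
    by (simp add: \<beta>_def power_divide sum_divide_distrib[symmetric] V_def normsq_def[symmetric])
  have s_t: "s g m h = t g m h / (sqrt (N g m) * sqrt (V h))" for g m h
    by (simp add: s_def t_def \<alpha>_def \<beta>_def sum_divide_distrib)
  have s_le: "(s g m h)\<^sup>2 \<le> \<chi> g h * s g m h" if "g \<in> G" "h \<in> H" "m < n" for g m h
  proof -
    have "(s g m h)\<^sup>2 \<le> (\<Sum>j<n. (\<alpha> g m j)\<^sup>2) * (\<Sum>j<n. (\<beta> h j)\<^sup>2)"
      unfolding s_def by (rule Cauchy_Schwarz_ineq_sum)
    then have "(s g m h)\<^sup>2 \<le> 1" using \<alpha>1 \<beta>1 that by simp
    then have s1: "\<bar>s g m h\<bar> \<le> 1" by (simp add: abs_square_le_1)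
    have "\<chi> g h * s g m h = \<chi> g h * t g m h / (sqrt (N g m) * sqrt (V h))"
      by (simp add: s_t)
    then have "0 \<le> \<chi> g h * s g m h"
      using sign_t[OF that] Npos[of g m] Vpos[of h] that by (simp add: N_def)
    then have "\<chi> g h * s g m h = \<bar>s g m h\<bar>"
      using unit[OF that(1,2)] by (metis abs_mult abs_of_nonneg mult_1)
    moreover have "(s g m h)\<^sup>2 \<le> \<bar>s g m h\<bar>"
      using mult_left_mono[OF s1, of "\<bar>s g m h\<bar>"] by (simp add: power2_eq_square)
    ultimately show ?thesis by simp
  qed
  define z where "z g j = (\<Sum>h\<in>H. \<chi> g h * \<beta> h j)" for g j
  define \<Lambda> where "\<Lambda> = sqrt (card H)"
  have \<Lambda>: "0 < \<Lambda>" "\<Lambda>\<^sup>2 = card H"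
    using H False by (auto simp: \<Lambda>_def card_gt_0_iff)
  have lower: "real (card G) / 3 \<le> (\<Sum>g\<in>G. \<Sum>m<n. (s g m h)\<^sup>2)" if "h \<in> H" for h
  proof -
    have "real (card G) / 3 * V h \<le> (\<Sum>g\<in>G. \<Sum>m<n. (t g m h)\<^sup>2 / N g m)"
      using iso[of "v' h"] by (simp add: t_def V_def N_def)
    also have "\<dots> = (\<Sum>g\<in>G. \<Sum>m<n. (s g m h)\<^sup>2) * V h"
      unfolding sum_distrib_right using Vpos[OF that] Npos
      by (intro sum.cong) (auto simp: s_t power_divide power_mult_distrib N_def less_imp_le)
    finally show ?thesis using Vpos[OF that] by simp
  qed
  have Z: "(\<Sum>g\<in>G. \<Sum>j<n. (z g j)\<^sup>2) = card G * card H"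
  proof -
    have "(\<Sum>g\<in>G. \<Sum>j<n. (z g j)\<^sup>2) = (\<Sum>g\<in>G. \<Sum>j<n. \<Sum>h\<in>H. \<Sum>h'\<in>H. \<beta> h j * \<beta> h' j * (\<chi> g h * \<chi> g h'))"
      by (simp add: z_def power2_eq_square sum_product algebra_simps)
    also have "\<dots> = (\<Sum>j<n. \<Sum>g\<in>G. \<Sum>h\<in>H. \<Sum>h'\<in>H. \<beta> h j * \<beta> h' j * (\<chi> g h * \<chi> g h'))"
      by (rule sum.swap)
    also have "\<dots> = (\<Sum>j<n. \<Sum>h\<in>H. \<Sum>h'\<in>H. \<Sum>g\<in>G. \<beta> h j * \<beta> h' j * (\<chi> g h * \<chi> g h'))"
      by (intro sum.cong refl trans[OF sum.swap] sum.swap)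
    also have "\<dots> = (\<Sum>j<n. \<Sum>h\<in>H. \<Sum>h'\<in>H. if h = h' then (\<beta> h j)\<^sup>2 * card G else 0)"
    proof (intro sum.cong refl)
      fix j h h' assume h: "h \<in> H" "h' \<in> H"
      show "(\<Sum>g\<in>G. \<beta> h j * \<beta> h' j * (\<chi> g h * \<chi> g h')) = (if h = h' then (\<beta> h j)\<^sup>2 * card G else 0)"
      proof (cases "h = h'")
        case True
        have "(\<Sum>g\<in>G. \<chi> g h * \<chi> g h) = (\<Sum>g\<in>G. 1)"
        proof (intro sum.cong refl)
          fix g assume "g \<in> G"
          then show "\<chi> g h * \<chi> g h = 1"
            using unit[OF _ h(1)] abs_mult_self_eq[of "\<chi> g h"] by simp
        qed
        then show ?thesis using True by (simp add: sum_distrib_left[symmetric] power2_eq_square)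
      qed (use orth[OF h] in \<open>simp add: sum_distrib_left[symmetric]\<close>)
    qed
    also have "\<dots> = (\<Sum>j<n. \<Sum>h\<in>H. (\<beta> h j)\<^sup>2 * card G)"
      using H by simp
    also have "\<dots> = (\<Sum>h\<in>H. \<Sum>j<n. (\<beta> h j)\<^sup>2 * card G)"
      by (rule sum.swap)
    also have "\<dots> = (\<Sum>h\<in>H. real (card G))"
      by (simp add: sum_distrib_right[symmetric] \<beta>1)
    finally show ?thesis by simp
  qed
  have "card G / 3 * \<Lambda>\<^sup>2 = (\<Sum>h\<in>H. real (card G) / 3)"
    by (simp add: \<Lambda>)
  also have "\<dots> \<le> (\<Sum>h\<in>H. \<Sum>g\<in>G. \<Sum>m<n. (s g m h)\<^sup>2)"
    by (intro sum_mono lower)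
  also have "\<dots> \<le> (\<Sum>h\<in>H. \<Sum>g\<in>G. \<Sum>m<n. \<chi> g h * s g m h)"
    by (intro sum_mono s_le) auto
  also have "\<dots> = (\<Sum>g\<in>G. \<Sum>m<n. \<Sum>h\<in>H. \<chi> g h * s g m h)"
    by (subst sum.swap) (intro sum.cong refl sum.swap)
  also have "\<dots> = (\<Sum>g\<in>G. \<Sum>m<n. \<Sum>j<n. \<alpha> g m j * z g j)"
  proof (intro sum.cong refl)
    fix g m
    have "(\<Sum>h\<in>H. \<chi> g h * s g m h) = (\<Sum>h\<in>H. \<Sum>j<n. \<alpha> g m j * (\<chi> g h * \<beta> h j))"
      by (simp add: s_def sum_distrib_left mult_ac)
    also have "\<dots> = (\<Sum>j<n. \<Sum>h\<in>H. \<alpha> g m j * (\<chi> g h * \<beta> h j))"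
      by (rule sum.swap)
    finally show "(\<Sum>h\<in>H. \<chi> g h * s g m h) = (\<Sum>j<n. \<alpha> g m j * z g j)"
      by (simp add: z_def sum_distrib_left)
  qed
  \<comment> \<open>Cauchy-Schwarz, in the form of the inequality \<open>2 * x * y \<le> \<Lambda> * x\<^sup>2 + y\<^sup>2 / \<Lambda>\<close>.
    The weight \<open>\<Lambda>\<close> balances the two terms, because the \<open>z g\<close> have mean squared norm \<open>\<Lambda>\<^sup>2\<close>.\<close>
  also have "\<dots> \<le> (\<Sum>g\<in>G. \<Sum>m<n. (\<Lambda> + (\<Sum>j<n. (z g j)\<^sup>2) / \<Lambda>) / 2)"
  proof (intro sum_mono)
    fix g m assume g: "g \<in> G" and m: "m \<in> {..<n}"
    have "(\<Sum>j<n. \<alpha> g m j * z g j) \<le> (\<Sum>j<n. (\<Lambda> * (\<alpha> g m j)\<^sup>2 + (z g j)\<^sup>2 / \<Lambda>) / 2)"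
    proof (rule sum_mono)
      fix j
      have "0 \<le> (\<Lambda> * \<alpha> g m j - z g j)\<^sup>2 / \<Lambda>" using \<Lambda> by simp
      also have "\<dots> = \<Lambda> * (\<alpha> g m j)\<^sup>2 + (z g j)\<^sup>2 / \<Lambda> - 2 * (\<alpha> g m j * z g j)"
        using \<Lambda>(1) by (simp add: power2_eq_square field_simps)
      finally show "\<alpha> g m j * z g j \<le> (\<Lambda> * (\<alpha> g m j)\<^sup>2 + (z g j)\<^sup>2 / \<Lambda>) / 2" by simp
    qed
    also have "\<dots> = (\<Lambda> + (\<Sum>j<n. (z g j)\<^sup>2) / \<Lambda>) / 2"
      using \<alpha>1[OF g, of m] m
      by (simp add: sum_divide_distrib[symmetric] sum.distrib sum_distrib_left[symmetric])
    finally show "(\<Sum>j<n. \<alpha> g m j * z g j) \<le> (\<Lambda> + (\<Sum>j<n. (z g j)\<^sup>2) / \<Lambda>) / 2" .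
  qed
  also have "\<dots> = n * (card G * \<Lambda> + (\<Sum>g\<in>G. \<Sum>j<n. (z g j)\<^sup>2) / \<Lambda>) / 2"
    by (simp add: sum_distrib_left[symmetric] sum_divide_distrib[symmetric] sum.distrib)
  also have "\<dots> = card G * n * \<Lambda>"
    unfolding Z using \<Lambda> by (simp add: \<Lambda>(2)[symmetric] power2_eq_square field_simps)
  finally have "card G * \<Lambda> * \<Lambda> \<le> card G * \<Lambda> * (3 * n)"
    by (simp add: power2_eq_square algebra_simps)
  moreover have "0 < card G * \<Lambda>" using G \<Lambda> by (simp add: card_gt_0_iff)
  ultimately have "\<Lambda> \<le> 3 * n" by (rule mult_left_le_imp_le)
  then have "\<Lambda>\<^sup>2 \<le> (3 * real n)\<^sup>2" using \<Lambda> by (intro power_mono) auto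
  then show ?thesis using \<Lambda> by (simp add: power_mult_distrib)
qed auto

section \<open>Sign patterns of polynomials\<close>

definition exponents :: "'x set \<Rightarrow> nat \<Rightarrow> ('x \<Rightarrow> nat) set" where
  "exponents X D = {e \<in> extensional X. sum e X \<le> D}"

definition monomial :: "'x set \<Rightarrow> ('x \<Rightarrow> nat) \<Rightarrow> ('x \<Rightarrow> real) \<Rightarrow> real" where
  "monomial X e x = (\<Prod>i\<in>X. x i ^ e i)"

text \<open>
  Polynomials are functions here: what counts below is that they lie in the span of few monomials.
\<close>

definition poly_degree_le :: "'x set \<Rightarrow> nat \<Rightarrow> (('x \<Rightarrow> real) \<Rightarrow> real) \<Rightarrow> bool" where
  "poly_degree_le X D f \<longleftrightarrow> (\<exists>c. \<forall>x. f x = (\<Sum>e\<in>exponents X D. c e * monomial X e x))"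

lemma poly_degree_leI:
  assumes "\<And>x. f x = (\<Sum>e\<in>exponents X D. c e * monomial X e x)"
  shows "poly_degree_le X D f"
  unfolding poly_degree_le_def by (intro exI[of _ c] allI assms)

lemma exponents_subset_PiE:
  assumes "finite X"
  shows "exponents X D \<subseteq> PiE X (\<lambda>_. {..D})"
proof
  fix e assume "e \<in> exponents X D"
  moreover from this have "e i \<le> D" if "i \<in> X" for i
    using member_le_sum[OF that, of e] assms by (auto simp: exponents_def)
  ultimately show "e \<in> PiE X (\<lambda>_. {..D})"
    by (auto simp: exponents_def PiE_def)
qed

lemma finite_exponents: "finite X \<Longrightarrow> finite (exponents X D)"
  by (rule finite_subset[OF exponents_subset_PiE]) (auto intro: finite_PiE)

text \<open>
  Give the exponent vector \<open>e\<close> the weight \<open>t ^ sum e X\<close>. Each of the vectors counted has weight at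
  least \<open>t ^ D\<close>, and the total weight is at most a product of \<open>card X\<close> geometric series. If \<open>D\<close> is a
  large multiple of \<open>card X\<close>, a good choice of \<open>t\<close> is near 1.
\<close>

lemma card_exponents_le:
  fixes t :: real
  assumes X: "finite X" and t: "0 < t" "t < 1"
  shows "real (card (exponents X D)) * t ^ D \<le> (1 / (1 - t)) ^ card X"
proof -
  have "real (card (exponents X D)) * t ^ D = (\<Sum>e\<in>exponents X D. t ^ D)"
    by simp
  also have "\<dots> \<le> (\<Sum>e\<in>exponents X D. \<Prod>i\<in>X. t ^ e i)"
  proof (rule sum_mono)
    fix e assume "e \<in> exponents X D"
    then show "t ^ D \<le> (\<Prod>i\<in>X. t ^ e i)"
      using t by (simp add: exponents_def power_sum[symmetric] power_decreasing)
  qed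
  also have "\<dots> \<le> (\<Sum>e\<in>PiE X (\<lambda>_. {..D}). \<Prod>i\<in>X. t ^ e i)"
    using X t by (intro sum_mono2 finite_PiE exponents_subset_PiE prod_nonneg) auto
  also have "\<dots> = (\<Prod>i\<in>X. \<Sum>j\<le>D. t ^ j)"
    using X by (intro prod_sum_PiE[symmetric]) auto
  also have "\<dots> \<le> (\<Prod>i\<in>X. 1 / (1 - t))"
  proof (intro prod_mono conjI sum_nonneg)
    fix i
    have "(\<Sum>j\<le>D. t ^ j) \<le> (\<Sum>j. t ^ j)"
      using t by (intro sum_le_suminf summable_geometric) auto
    then show "(\<Sum>j\<le>D. t ^ j) \<le> 1 / (1 - t)"
      using suminf_geometric[of t] t by simp
  qed (use t in auto)
  finally show ?thesis by simp
qed

lemma poly_degree_le_sum: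
  assumes "\<And>i. i \<in> I \<Longrightarrow> poly_degree_le X D (f i)"
  shows "poly_degree_le X D (\<lambda>x. \<Sum>i\<in>I. f i x)"
proof -
  have "\<forall>i\<in>I. \<exists>c. \<forall>x. f i x = (\<Sum>e\<in>exponents X D. c e * monomial X e x)"
    using assms by (simp add: poly_degree_le_def)
  from bchoice[OF this] obtain c
    where c': "\<forall>i\<in>I. \<forall>x. f i x = (\<Sum>e\<in>exponents X D. c i e * monomial X e x)" ..
  have c: "f i x = (\<Sum>e\<in>exponents X D. c i e * monomial X e x)" if "i \<in> I" for i x
    using c'[rule_format, OF that] .
  have "(\<Sum>i\<in>I. f i x) = (\<Sum>e\<in>exponents X D. (\<Sum>i\<in>I. c i e) * monomial X e x)" for x
    by (simp add: c sum_distrib_right sum.swap[of _ I])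
  then show ?thesis by (rule poly_degree_leI)
qed

lemma poly_degree_le_monomial:
  assumes "finite X" "e \<in> exponents X D"
  shows "poly_degree_le X D (\<lambda>x. k * monomial X e x)"
proof (rule poly_degree_leI)
  fix x
  have "(\<Sum>e'\<in>exponents X D. (if e' = e then k else 0) * monomial X e' x) =
      (\<Sum>e'\<in>exponents X D. if e' = e then k * monomial X e' x else 0)"
    by (intro sum.cong) auto
  then show "k * monomial X e x = (\<Sum>e'\<in>exponents X D. (if e' = e then k else 0) * monomial X e' x)"
    using assms finite_exponents[OF assms(1), of D] by simp
qed

lemma poly_degree_le_weaken:
  assumes "finite X" "D \<le> D'" "poly_degree_le X D f"
  shows "poly_degree_le X D' f"
proof -
  from assms(3) obtain c where c: "\<forall>x. f x = (\<Sum>e\<in>exponents X D. c e * monomial X e x)"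
    unfolding poly_degree_le_def ..
  have "poly_degree_le X D' (\<lambda>x. \<Sum>e\<in>exponents X D. c e * monomial X e x)"
  proof (rule poly_degree_le_sum)
    fix e assume "e \<in> exponents X D"
    then have "e \<in> exponents X D'" using assms(2) by (simp add: exponents_def)
    then show "poly_degree_le X D' (\<lambda>x. c e * monomial X e x)"
      by (rule poly_degree_le_monomial[OF assms(1)])
  qed
  then show ?thesis by (simp only: c[rule_format, symmetric])
qed

lemma poly_degree_le_mult:
  assumes X: "finite X" and f: "poly_degree_le X D f" and g: "poly_degree_le X D' g"
  shows "poly_degree_le X (D + D') (\<lambda>x. f x * g x)"
proof -
  from f obtain c where c: "\<forall>x. f x = (\<Sum>e\<in>exponents X D. c e * monomial X e x)"
    unfolding poly_degree_le_def ..
  from g obtain c' where c': "\<forall>x. g x = (\<Sum>e\<in>exponents X D'. c' e * monomial X e x)"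
    unfolding poly_degree_le_def ..
  let ?s = "\<lambda>e e'. \<lambda>i\<in>X. e i + e' i"
  have fg: "f x * g x = (\<Sum>e\<in>exponents X D. \<Sum>e'\<in>exponents X D'. c e * c' e' * monomial X (?s e e') x)" for x
    unfolding c[rule_format] c'[rule_format] sum_product
    by (intro sum.cong refl) (simp add: monomial_def power_add prod.distrib)
  have s: "?s e e' \<in> exponents X (D + D')" if "e \<in> exponents X D" "e' \<in> exponents X D'" for e e'
    using that by (simp add: exponents_def sum.distrib add_mono)
  show ?thesis
    unfolding fg by (intro poly_degree_le_sum poly_degree_le_monomial X s)
qed

lemma poly_degree_le_var:
  assumes "finite X" "i \<in> X"
  shows "poly_degree_le X 1 (\<lambda>x. x i)"
proof -
  let ?e = "\<lambda>j\<in>X. if j = i then 1 else 0"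
  have "?e \<in> exponents X 1" using assms by (simp add: exponents_def)
  moreover have "x i = 1 * monomial X ?e x" for x :: "'a \<Rightarrow> real"
  proof -
    have "monomial X ?e x = (\<Prod>j\<in>X. if j = i then x j else 1)"
      unfolding monomial_def by (intro prod.cong) auto
    then show ?thesis using assms by simp
  qed
  ultimately show ?thesis
    using poly_degree_le_monomial[OF assms(1), of ?e 1 1] by simp
qed

lemma poly_degree_le_one:
  assumes "finite X"
  shows "poly_degree_le X D (\<lambda>x. 1)"
  using poly_degree_le_monomial[OF assms, of "\<lambda>i\<in>X. 0" D 1]
  by (simp add: exponents_def monomial_def)

lemma poly_degree_le_prod:
  assumes X: "finite X" and "finite S" and "\<And>s. s \<in> S \<Longrightarrow> poly_degree_le X k (f s)"
  shows "poly_degree_le X (k * card S) (\<lambda>x. \<Prod>s\<in>S. f s x)"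
  using assms(2,3)
proof (induction S rule: finite_induct)
  case (insert s S)
  have "poly_degree_le X (k + k * card S) (\<lambda>x. f s x * (\<Prod>s\<in>S. f s x))"
    by (rule poly_degree_le_mult[OF X]) (use insert in auto)
  then show ?case using insert.hyps by simp
qed (use poly_degree_le_one[OF X] in simp)

text \<open>
  A bound in the spirit of Warren's theorem on the number of strict sign patterns, obtained from
  linear algebra. For a pattern \<open>h\<close> attained at \<open>x h\<close> and a subset \<open>S\<close> of \<open>E\<close>, the number
  \<open>\<Prod>e\<in>S. f e (x h)\<close> has the sign \<open>\<Prod>e\<in>S. \<sigma> h e\<close>. These signs are the values at \<open>h\<close> of the
  characters of the cube, so the columns belonging to distinct \<open>h\<close> are orthogonal. On the other hand,
  expanding the product into monomials writes the number as an inner product of a vector depending on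
  \<open>S\<close> and a vector depending on \<open>h\<close>, with one coordinate for each monomial of degree at most
  \<open>k * card E\<close>. Thus Forster's bound applies.
\<close>

lemma card_sign_patterns_le:
  fixes f :: "'e \<Rightarrow> ('x \<Rightarrow> real) \<Rightarrow> real" and \<sigma> :: "'h \<Rightarrow> 'e \<Rightarrow> real"
  assumes X: "finite X" and E: "finite E" and H: "finite H"
  assumes poly: "\<And>e. e \<in> E \<Longrightarrow> poly_degree_le X k (f e)"
  assumes attained: "\<And>h. h \<in> H \<Longrightarrow> \<exists>x. \<forall>e\<in>E. sgn (f e x) = \<sigma> h e"
  assumes unit: "\<And>h e. h \<in> H \<Longrightarrow> e \<in> E \<Longrightarrow> \<bar>\<sigma> h e\<bar> = 1"
  assumes distinct: "\<And>h h'. h \<in> H \<Longrightarrow> h' \<in> H \<Longrightarrow> h \<noteq> h' \<Longrightarrow> \<exists>e\<in>E. \<sigma> h e \<noteq> \<sigma> h' e"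
  shows "real (card H) \<le> 9 * (real (card (exponents X (k * card E))))\<^sup>2"
proof -
  define M where "M = exponents X (k * card E)"
  have M: "finite M" by (simp add: M_def finite_exponents X)
  then obtain en where en: "bij_betw en {..<card M} M"
    using ex_bij_betw_nat_finite by (metis atLeast0LessThan)
  have "poly_degree_le X (k * card E) (\<lambda>x. \<Prod>e\<in>S. f e x)" if "S \<in> Pow E" for S
  proof (rule poly_degree_le_weaken[OF X])
    show "k * card S \<le> k * card E"
      using that E by (simp add: card_mono)
    show "poly_degree_le X (k * card S) (\<lambda>x. \<Prod>e\<in>S. f e x)"
      using that E by (intro poly_degree_le_prod[OF X] poly) (auto intro: finite_subset)
  qed
  then have "\<forall>S\<in>Pow E. \<exists>c. \<forall>x. (\<Prod>e\<in>S. f e x) = (\<Sum>m\<in>M. c m * monomial X m x)"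
    unfolding poly_degree_le_def M_def by simp
  from bchoice[OF this] obtain c
    where c': "\<forall>S\<in>Pow E. \<forall>x. (\<Prod>e\<in>S. f e x) = (\<Sum>m\<in>M. c S m * monomial X m x)" ..
  have c: "(\<Prod>e\<in>S. f e x) = (\<Sum>m\<in>M. c S m * monomial X m x)" if "S \<in> Pow E" for S x
    using c'[rule_format, OF that] .
  have "\<forall>h\<in>H. \<exists>x. \<forall>e\<in>E. sgn (f e x) = \<sigma> h e"
    using attained by simp
  from bchoice[OF this] obtain x where x': "\<forall>h\<in>H. \<forall>e\<in>E. sgn (f e (x h)) = \<sigma> h e" ..
  have x: "sgn (f e (x h)) = \<sigma> h e" if "h \<in> H" "e \<in> E" for h e
    using x'[rule_format, OF that] .
  define \<chi> where "\<chi> S h = (\<Prod>e\<in>S. \<sigma> h e)" for S h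
  have "real (card H) \<le> 9 * (real (card M))\<^sup>2"
  proof (rule card_le_of_orthogonal_signs[where G = "Pow E" and \<chi> = \<chi>
        and u = "\<lambda>S i. c S (en i)" and v = "\<lambda>h i. monomial X (en i) (x h)"])
    fix S h assume S: "S \<in> Pow E" and h: "h \<in> H"
    show "\<bar>\<chi> S h\<bar> = 1"
      using S unit[OF h] unfolding \<chi>_def abs_prod by (intro prod.neutral) auto
    have "(\<Sum>i<card M. c S (en i) * monomial X (en i) (x h)) = (\<Prod>e\<in>S. f e (x h))"
      unfolding c[OF S] by (rule sum.reindex_bij_betw[OF en])
    then have "\<chi> S h * (\<Sum>i<card M. c S (en i) * monomial X (en i) (x h)) = (\<Prod>e\<in>S. \<sigma> h e * f e (x h))"
      by (simp add: \<chi>_def prod.distrib)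
    also have "0 < \<dots>"
    proof (rule prod_pos)
      fix e assume "e \<in> S"
      then have e: "e \<in> E" using S by auto
      then have "\<sigma> h e * f e (x h) = \<bar>f e (x h)\<bar>"
        using x[OF h e] by (metis abs_sgn mult.commute)
      moreover have "f e (x h) \<noteq> 0" using x[OF h e] unit[OF h e] by auto
      ultimately show "0 < \<sigma> h e * f e (x h)" by simp
    qed
    finally show "0 < \<chi> S h * (\<Sum>i<card M. c S (en i) * monomial X (en i) (x h))" .
  next
    fix h h' assume h: "h \<in> H" "h' \<in> H" "h \<noteq> h'"
    then obtain e where e: "e \<in> E" "\<sigma> h e \<noteq> \<sigma> h' e" using distinct by blast
    \<comment> \<open>The sum over all subsets factors, and the factor of a coordinate where \<open>h\<close> and \<open>h'\<close> differ is 0.\<close>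
    have "\<sigma> h e * \<sigma> h' e = -1"
      using unit[OF h(1) e(1)] unit[OF h(2) e(1)] e(2) by (auto simp: abs_if split: if_splits)
    then have "(\<Prod>e\<in>E. \<sigma> h e * \<sigma> h' e + 1) = 0"
      using E e(1) by (auto intro!: prod_zero bexI[of _ e])
    then show "(\<Sum>S\<in>Pow E. \<chi> S h * \<chi> S h') = 0"
      using prod_add[OF E, of "\<lambda>e. \<sigma> h e * \<sigma> h' e" "\<lambda>_. 1"] by (simp add: \<chi>_def prod.distrib)
  qed (use E H in auto)
  then show ?thesis by (simp add: M_def)
qed

text \<open>
  The weight \<open>t = 31/32\<close> satisfies \<open>t ^ 16 \<ge> 1/2\<close>, so the degree contributes at most
  \<open>2 ^ (m / 8)\<close> to the number of monomials, and the variables contribute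
  \<open>32 ^ card X = 2 ^ (5 * card X)\<close>, which is at most \<open>2 ^ (m / 8)\<close> as well. This is where the
  constant 40 comes from.
\<close>

lemma card_exponents_power_le:
  assumes "finite X" "40 * card X \<le> m"
  shows "(real (card (exponents X (2 * m)))) ^ 4 \<le> 2 ^ m"
proof -
  define r where "r = real (card (exponents X (2 * m)))"
  have "r * (31/32) ^ (2 * m) \<le> 32 ^ card X"
    using card_exponents_le[OF assms(1), of "31/32" "2 * m"] by (simp add: r_def)
  then have "(r * (31/32) ^ (2 * m)) ^ 8 \<le> (32 ^ card X) ^ 8"
    by (intro power_mono) (auto simp: r_def)
  moreover have "((31/32::real) ^ (2 * m)) ^ 8 = ((31/32) ^ 16) ^ m"
    unfolding power_mult[symmetric] by (intro arg_cong2[where f = power] refl) simp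
  moreover have "((32::real) ^ card X) ^ 8 = ((2 ^ 5) ^ card X) ^ 8"
    by simp
  moreover have "((2 ^ 5) ^ card X) ^ 8 = (2::real) ^ (40 * card X)"
    unfolding power_mult[symmetric] by (intro arg_cong2[where f = power] refl) simp
  ultimately have "r ^ 8 * ((31/32) ^ 16) ^ m \<le> 2 ^ (40 * card X)"
    by (simp only: power_mult_distrib)
  also have "\<dots> \<le> 2 ^ m" using assms by (intro power_increasing) auto
  finally have 1: "r ^ 8 * ((31/32) ^ 16) ^ m \<le> 2 ^ m" .
  have "1/2 \<le> (31/32::real) ^ 16" by (simp add: power_divide)
  then have "(1/2) ^ m \<le> ((31/32::real) ^ 16) ^ m" by (rule power_mono) simp
  then have "r ^ 8 * (1/2) ^ m \<le> r ^ 8 * ((31/32) ^ 16) ^ m"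
    by (intro mult_left_mono) (auto simp: r_def)
  with 1 have "r ^ 8 * (1/2) ^ m \<le> 2 ^ m" by simp
  then have "r ^ 8 \<le> 2 ^ m * 2 ^ m" by (simp add: power_divide field_simps)
  moreover have "r ^ 8 = (r ^ 4)\<^sup>2"
    unfolding power_mult[symmetric] by simp
  ultimately have "(r ^ 4)\<^sup>2 \<le> (2 ^ m)\<^sup>2" by (simp only: power2_eq_square)
  then show ?thesis unfolding r_def by (rule power2_le_imp_le) simp
qed

section \<open>The index of a sign complex\<close>

definition facet :: "'c set \<Rightarrow> ('r \<Rightarrow> 'c \<Rightarrow> entry) \<Rightarrow> 'r \<Rightarrow> bool \<Rightarrow> ('c \<times> bool) set" where
  "facet C A r b = (if b then pos_facet C A r else neg_facet C A r)"

definition pair_sum :: "'v set \<Rightarrow> ('v \<Rightarrow> real) \<Rightarrow> real" where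
  "pair_sum s x = (\<Sum>v\<in>s. \<Sum>w\<in>s - {v}. x v * x w)"

lemma mem_facet:
  "(c, b') \<in> facet C A r b \<longleftrightarrow> c \<in> C \<and> A r c = (if b = b' then Plus else Minus)"
  by (cases b; cases b') (auto simp: facet_def pos_facet_def neg_facet_def)

lemma finite_facet: "finite C \<Longrightarrow> finite (facet C A r b)"
  by (rule finite_subset[of _ "C \<times> UNIV"]) (auto simp: mem_facet)

lemma flip_flip [simp]: "flip (flip v) = v"
  by (simp add: flip_def)

lemma flip_image_facet: "flip ` facet C A r b = facet C A r (\<not> b)"
proof (intro equalityI subsetI)
  fix v assume "v \<in> facet C A r (\<not> b)"
  then have "flip v \<in> facet C A r b" by (cases v) (auto simp: flip_def mem_facet)
  then show "v \<in> flip ` facet C A r b" by (metis flip_flip imageI)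
qed (auto simp: flip_def mem_facet)

lemma pair_sum_flip: "pair_sum (facet C A r b) (x \<circ> flip) = pair_sum (facet C A r (\<not> b)) x"
proof -
  have inj: "inj_on flip B" for B :: "('a \<times> bool) set"
    by (metis flip_flip inj_onI)
  have "pair_sum (flip ` s) x = pair_sum s (x \<circ> flip)" for s :: "('a \<times> bool) set"
  proof -
    have "flip ` s - {flip v} = flip ` (s - {v})" for v
      using inj_on_image_set_diff[OF inj[of UNIV], of s "{v}"] by simp
    then show ?thesis
      by (simp add: pair_sum_def sum.reindex[OF inj] o_def)
  qed
  then show ?thesis by (metis flip_image_facet)
qed

lemma sign_complex_iff:
  "s \<in> sign_complex R C A \<longleftrightarrow> (\<exists>r\<in>R. \<exists>b. s \<subseteq> facet C A r b)"
  unfolding sign_complex_def facet_def by (auto split: if_splits)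

text \<open>
  Two rows with at most one common column have facets with at most one common vertex, and the two
  facets of one row are disjoint. So an edge lies in one facet only.
\<close>

lemma facet_eqI:
  assumes inter: "\<And>c c'. r \<noteq> r' \<Longrightarrow> c \<noteq> c' \<Longrightarrow>
    A r c \<noteq> Star \<Longrightarrow> A r c' \<noteq> Star \<Longrightarrow> A r' c \<noteq> Star \<Longrightarrow> A r' c' \<noteq> Star \<Longrightarrow> False"
  assumes "v \<noteq> w" "v \<in> facet C A r b" "w \<in> facet C A r b" "v \<in> facet C A r' b'" "w \<in> facet C A r' b'"
  shows "r = r' \<and> b = b'"
proof -
  obtain c d c' d' where vw: "v = (c, d)" "w = (c', d')" by (cases v; cases w)
  have "c \<noteq> c'"
    using assms(2-4) by (auto simp: vw mem_facet split: if_splits)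
  moreover have "A r c \<noteq> Star" "A r c' \<noteq> Star" "A r' c \<noteq> Star" "A r' c' \<noteq> Star"
    using assms(3-6) by (auto simp: vw mem_facet split: if_splits)
  ultimately have "r = r'" using inter by blast
  then show ?thesis
    using assms(3,5) by (auto simp: vw mem_facet split: if_splits)
qed

text \<open>
  The two functions \<open>g\<close> and \<open>h\<close> on the realization are odd and have no common zero, so \<open>(g, h)\<close>
  can be normalized to an equivariant map into the circle. The function \<open>h\<close> adds up the products
  \<open>x v * x w\<close> over the edges (in both orders), with the sign of the facet that contains
  the edge. At a point of a facet that is not a vertex, all edges of the support belong to this facet, so nothing cancels and \<open>h\<close> is
  not 0. At a vertex, \<open>g\<close> is 1 or -1. Geometrically, the complex is equivariantly homotopy
  equivalent to the graph obtained by replacing each facet by the cone over its vertices.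
\<close>

lemma Z2_index_sign_complex_le_1:
  fixes R :: "'r set" and C :: "'c set" and A :: "'r \<Rightarrow> 'c \<Rightarrow> entry"
  assumes fin: "finite R" "finite C"
  assumes inter: "\<And>r r' c c'. r \<in> R \<Longrightarrow> r' \<in> R \<Longrightarrow> r \<noteq> r' \<Longrightarrow> c \<noteq> c' \<Longrightarrow>
    A r c \<noteq> Star \<Longrightarrow> A r c' \<noteq> Star \<Longrightarrow> A r' c \<noteq> Star \<Longrightarrow> A r' c' \<noteq> Star \<Longrightarrow> False"
  shows "Z2_index (sign_complex R C A) flip \<le> 1"
proof -
  define K where "K = sign_complex R C A"
  define \<epsilon> :: "bool \<Rightarrow> real" where "\<epsilon> b = (if b then 1 else -1)" for b
  define g where "g x = (\<Sum>c\<in>C. x (c, True) - x (c, False))" for x :: "'c \<times> bool \<Rightarrow> real"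
  define h where "h x = (\<Sum>r\<in>R. \<Sum>b\<in>UNIV. \<epsilon> b * pair_sum (facet C A r b) x)" for x
  define n where "n x = sqrt ((g x)\<^sup>2 + (h x)\<^sup>2)" for x
  have g_flip: "g (x \<circ> flip) = - g x" for x
    by (simp add: g_def flip_def sum_negf[symmetric])
  have h_flip: "h (x \<circ> flip) = - h x" for x
    by (simp add: h_def pair_sum_flip UNIV_bool \<epsilon>_def sum_negf[symmetric])
  have n_flip: "n (x \<circ> flip) = n x" for x
    by (simp add: n_def g_flip h_flip)
  have nz: "g x \<noteq> 0 \<or> h x \<noteq> 0" if x: "x \<in> realization K" for x
  proof -
    define s where "s = {v. x v \<noteq> 0}"
    have x0: "0 \<le> x v" for v using x by (simp add: realization_def del: split_paired_All)
    have fs: "finite s" and sK: "s \<in> K" and s1: "sum x s = 1"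
      using x by (auto simp: realization_def s_def)
    obtain r b where r: "r \<in> R" and s: "s \<subseteq> facet C A r b"
      using sK unfolding K_def sign_complex_iff by blast
    show ?thesis
    proof (cases "\<exists>v\<in>s. \<exists>w\<in>s. v \<noteq> w")
      case True
      then obtain v w where vw: "v \<in> s" "w \<in> s" "v \<noteq> w" by blast
      \<comment> \<open>The support of \<open>x\<close> contains no edge of any other facet.\<close>
      have other: "pair_sum (facet C A r' b') x = 0" if "r' \<in> R" "(r', b') \<noteq> (r, b)" for r' b'
        unfolding pair_sum_def
      proof (intro sum.neutral ballI)
        fix v w assume "v \<in> facet C A r' b'" "w \<in> facet C A r' b' - {v}"
        then have "v \<noteq> w" and vw': "v \<in> facet C A r' b'" "w \<in> facet C A r' b'" by auto
        have "\<not> (v \<in> s \<and> w \<in> s)"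
        proof
          assume "v \<in> s \<and> w \<in> s"
          then have "v \<in> facet C A r b" "w \<in> facet C A r b" using s by auto
          from facet_eqI[OF inter[OF r that(1)] \<open>v \<noteq> w\<close> this vw'] that(2) show False by simp
        qed
        then show "x v * x w = 0" by (auto simp: s_def)
      qed
      have "0 < x v * x w"
        using vw x0[of v] x0[of w] by (simp add: s_def less_le)
      also have "\<dots> \<le> (\<Sum>w\<in>facet C A r b - {v}. x v * x w)"
        using vw s x0 fin by (intro member_le_sum) (auto simp: finite_facet)
      also have "\<dots> \<le> pair_sum (facet C A r b) x"
        unfolding pair_sum_def using vw s x0 fin
        by (intro member_le_sum[of v]) (auto simp: finite_facet intro!: sum_nonneg)
      finally have pos: "0 < pair_sum (facet C A r b) x" .
      have "h x = (\<Sum>r'\<in>R. if r' = r then \<epsilon> b * pair_sum (facet C A r b) x else 0)"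
        unfolding h_def
      proof (intro sum.cong refl)
        fix r' assume r': "r' \<in> R"
        show "(\<Sum>b'\<in>UNIV. \<epsilon> b' * pair_sum (facet C A r' b') x) =
            (if r' = r then \<epsilon> b * pair_sum (facet C A r b) x else 0)"
          using other[OF r'] by (cases b) (auto simp: UNIV_bool)
      qed
      also have "\<dots> = \<epsilon> b * pair_sum (facet C A r b) x"
        using r fin by simp
      finally show ?thesis using pos by (simp add: \<epsilon>_def)
    next
      case False
      have "s \<noteq> {}" using s1 by auto
      then obtain v where v: "v \<in> s" by blast
      with False have sv: "s = {v}" by blast
      then have xv: "x v = 1" using s1 by simp
      have xw: "x w = 0" if "w \<noteq> v" for w using sv that by (auto simp: s_def)
      obtain c d where cd: "v = (c, d)" by (cases v)
      have c: "c \<in> C" using v s by (auto simp: cd mem_facet)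
      have "g x = (\<Sum>c'\<in>C. if c' = c then \<epsilon> d else 0)"
        unfolding g_def using xv xw by (intro sum.cong) (auto simp: cd \<epsilon>_def)
      also have "\<dots> = \<epsilon> d" using c fin by simp
      finally show ?thesis by (simp add: \<epsilon>_def)
    qed
  qed
  have n_pos: "0 < n x" if "x \<in> realization K" for x
    using nz[OF that] by (simp add: n_def sum_power2_gt_zero_iff)
  have top: "topspace (realization_top K) = realization K"
    by (simp add: realization_top_def)
  have coord: "continuous_map (realization_top K) euclideanreal (\<lambda>x. x v)" for v
    unfolding realization_top_def
    by (intro continuous_map_from_subtopology continuous_map_product_projection) simp
  have cg: "continuous_map (realization_top K) euclideanreal g"
    unfolding g_def using fin by (intro continuous_map_sum continuous_map_diff coord) auto
  have ch: "continuous_map (realization_top K) euclideanreal h"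
    unfolding h_def pair_sum_def using fin
    by (intro continuous_map_sum continuous_map_real_mult coord) (auto simp: finite_facet)
  have cn: "continuous_map (realization_top K) euclideanreal n"
    unfolding n_def using cg ch
    by (intro continuous_map_sqrt continuous_map_add continuous_map_real_pow) auto
  define f where "f x i = (if i = 0 then g x / n x else if i = 1 then h x / n x else 0)"
    for x and i :: nat
  have "continuous_map (realization_top K) (nsphere 1) f"
    unfolding nsphere continuous_map_in_subtopology continuous_map_componentwise_UNIV
  proof (intro conjI allI Pi_I)
    fix i
    have "continuous_map (realization_top K) euclideanreal (\<lambda>x. g x / n x)"
      "continuous_map (realization_top K) euclideanreal (\<lambda>x. h x / n x)"
      using less_imp_neq[OF n_pos, symmetric]
      by (intro continuous_map_real_divide cg ch cn; simp add: top)+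
    then show "continuous_map (realization_top K) euclideanreal (\<lambda>x. f x i)"
      unfolding f_def by (cases "i = 0"; cases "i = 1") simp_all
  next
    fix x assume "x \<in> topspace (realization_top K)"
    then have "0 < n x" by (simp add: top n_pos)
    moreover from this have "(n x)\<^sup>2 = (g x)\<^sup>2 + (h x)\<^sup>2"
      by (simp add: n_def)
    ultimately have "((g x)\<^sup>2 + (h x)\<^sup>2) / (n x)\<^sup>2 = 1"
      by (metis divide_self_if less_irrefl power_not_zero)
    then have "(g x / n x)\<^sup>2 + (h x / n x)\<^sup>2 = 1"
      by (simp only: power_divide add_divide_distrib)
    then show "f x \<in> {x. (\<Sum>i\<le>1. (x i)\<^sup>2) = 1 \<and> (\<forall>i>1. x i = 0)}"
      by (simp add: f_def)
  qed
  moreover have "f (x \<circ> flip) = (\<lambda>i. - f x i)" for x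
    by (rule ext) (simp add: f_def g_flip h_flip n_flip)
  ultimately have "\<exists>f. continuous_map (realization_top K) (nsphere 1) f \<and>
      (\<forall>x\<in>realization K. f (x \<circ> flip) = (\<lambda>i. - f x i))"
    by (intro exI[of _ f] conjI ballI)
  then have "enat 1 \<in> {enat d | d. \<exists>f. continuous_map (realization_top K) (nsphere d) f \<and>
      (\<forall>x\<in>realization K. f (x \<circ> flip) = (\<lambda>i. - f x i))}"
    by (intro CollectI exI[of _ 1] conjI refl)
  then show ?thesis
    unfolding Z2_index_def K_def[symmetric] one_enat_def by (rule Inf_lower)
qed

section \<open>The projective plane over a finite field\<close>

definition lin3 :: "'a ring \<Rightarrow> 'a vec3 \<Rightarrow> 'a vec3 \<Rightarrow> 'a \<Rightarrow> 'a \<Rightarrow> 'a vec3" where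
  "lin3 F v w a b = add3 F (scale3 F a v) (scale3 F b w)"

locale finite_field = field F for F :: "'a ring" (structure) +
  assumes finite_carrier: "finite (carrier F)"
begin

lemma space3_cases:
  assumes "v \<in> space3 F"
  obtains x y z where "v = (x, y, z)" "x \<in> carrier F" "y \<in> carrier F" "z \<in> carrier F"
  using assms by (auto simp: space3_def)

lemma lin3_closed:
  assumes "v \<in> space3 F" "w \<in> space3 F" "a \<in> carrier F" "b \<in> carrier F"
  shows "lin3 F v w a b \<in> space3 F"
  using assms by (auto simp: lin3_def space3_def)

lemma scale3_closed: "v \<in> space3 F \<Longrightarrow> a \<in> carrier F \<Longrightarrow> scale3 F a v \<in> space3 F"
  by (auto simp: space3_def)

lemma scale3_one: "v \<in> space3 F \<Longrightarrow> scale3 F \<one> v = v"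
  by (auto simp: space3_def)

lemma scale3_scale3:
  "v \<in> space3 F \<Longrightarrow> a \<in> carrier F \<Longrightarrow> b \<in> carrier F \<Longrightarrow> scale3 F a (scale3 F b v) = scale3 F (a \<otimes> b) v"
  by (auto simp: space3_def m_assoc)

lemma scale3_lin3:
  assumes "v \<in> space3 F" "w \<in> space3 F" "a \<in> carrier F" "b \<in> carrier F" "c \<in> carrier F"
  shows "scale3 F c (lin3 F v w a b) = lin3 F v w (c \<otimes> a) (c \<otimes> b)"
  using assms by (auto simp: lin3_def space3_def r_distr m_assoc)

lemma lin3_lin3:
  assumes "v \<in> space3 F" "w \<in> space3 F"
    "a \<in> carrier F" "b \<in> carrier F" "a' \<in> carrier F" "b' \<in> carrier F" "c \<in> carrier F" "d \<in> carrier F"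
  shows "lin3 F (lin3 F v w a b) (lin3 F v w a' b') c d =
    lin3 F v w (c \<otimes> a \<oplus> d \<otimes> a') (c \<otimes> b \<oplus> d \<otimes> b')"
  using assms by (auto simp: lin3_def space3_def r_distr l_distr m_assoc a_ac)

lemma lin3_left: "v \<in> space3 F \<Longrightarrow> w \<in> space3 F \<Longrightarrow> a \<in> carrier F \<Longrightarrow> lin3 F v w a \<zero> = scale3 F a v"
  by (auto simp: lin3_def space3_def)

lemma lin3_right: "v \<in> space3 F \<Longrightarrow> w \<in> space3 F \<Longrightarrow> a \<in> carrier F \<Longrightarrow> lin3 F v w \<zero> a = scale3 F a w"
  by (auto simp: lin3_def space3_def)

text \<open>
  Coordinates with respect to independent vectors are unique; independence is stated for
  representations of the zero vector only.
\<close>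

lemma indep3_lin3_eqD:
  assumes ind: "indep3 F v w" and v: "v \<in> space3 F" "w \<in> space3 F"
    and c: "a \<in> carrier F" "b \<in> carrier F" "c \<in> carrier F" "d \<in> carrier F"
    and eq: "lin3 F v w a b = lin3 F v w c d"
  shows "a = c \<and> b = d"
proof -
  have ring: "(a \<ominus> c) \<otimes> x \<oplus> (b \<ominus> d) \<otimes> y = \<zero>"
    if "a \<otimes> x \<oplus> b \<otimes> y = c \<otimes> x \<oplus> d \<otimes> y" "x \<in> carrier F" "y \<in> carrier F" for x y
  proof -
    have "(a \<ominus> c) \<otimes> x \<oplus> (b \<ominus> d) \<otimes> y = (a \<otimes> x \<oplus> b \<otimes> y) \<ominus> (c \<otimes> x \<oplus> d \<otimes> y)"
      using c that(2,3) by (simp add: minus_eq l_distr l_minus minus_add a_ac)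
    also have "\<dots> = \<zero>" using c that by (simp add: minus_eq r_neg)
    finally show ?thesis .
  qed
  have "lin3 F v w (a \<ominus> c) (b \<ominus> d) = zero3 F"
    using v eq ring by (auto simp: lin3_def zero3_def space3_def)
  moreover have "a \<ominus> c \<in> carrier F" "b \<ominus> d \<in> carrier F" using c by simp_all
  ultimately have "a \<ominus> c = \<zero> \<and> b \<ominus> d = \<zero>"
    using ind unfolding indep3_def lin3_def by blast
  then show ?thesis
    using minus_equality[of a "\<ominus> c"] minus_equality[of b "\<ominus> d"] c by (simp add: minus_eq)
qed

lemma span2_eq: "span2 F v w = (\<lambda>(a, b). lin3 F v w a b) ` (carrier F \<times> carrier F)"
  unfolding span2_def lin3_def by force

lemma span2I: "a \<in> carrier F \<Longrightarrow> b \<in> carrier F \<Longrightarrow> lin3 F v w a b \<in> span2 F v w"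
  by (auto simp: span2_eq)

lemma span2E:
  assumes "x \<in> span2 F v w"
  obtains a b where "a \<in> carrier F" "b \<in> carrier F" "x = lin3 F v w a b"
  using assms that unfolding span2_eq by fastforce

lemma span1E:
  assumes "x \<in> span1 F v"
  obtains a where "a \<in> carrier F" "x = scale3 F a v"
  using assms unfolding span1_def by blast

lemma pg_pointsI: "v \<in> space3 F \<Longrightarrow> v \<noteq> zero3 F \<Longrightarrow> span1 F v \<in> pg_points F"
  unfolding pg_points_def by blast

lemma pg_linesI: "v \<in> space3 F \<Longrightarrow> w \<in> space3 F \<Longrightarrow> indep3 F v w \<Longrightarrow> span2 F v w \<in> pg_lines F"
  unfolding pg_lines_def by blast

lemma mem_span1: "v \<in> space3 F \<Longrightarrow> v \<in> span1 F v"
  unfolding span1_def by (force simp: scale3_one)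

lemma span1_subset:
  assumes "v \<in> space3 F" "w \<in> space3 F" "a \<in> carrier F" "b \<in> carrier F"
  shows "span1 F (lin3 F v w a b) \<subseteq> span2 F v w"
proof
  fix x assume "x \<in> span1 F (lin3 F v w a b)"
  then obtain c where "c \<in> carrier F" "x = scale3 F c (lin3 F v w a b)" by (rule span1E)
  then show "x \<in> span2 F v w" using assms by (simp add: scale3_lin3 span2I)
qed

lemma finite_space3: "finite (space3 F)"
  by (simp add: space3_def finite_carrier)

lemma finite_pg_points: "finite (pg_points F)"
proof (rule finite_subset)
  show "pg_points F \<subseteq> Pow (space3 F)"
    unfolding pg_points_def span1_def using scale3_closed by blast
qed (simp add: finite_space3)

lemma finite_pg_lines: "finite (pg_lines F)"
proof (rule finite_subset)
  show "pg_lines F \<subseteq> Pow (space3 F)"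
    unfolding pg_lines_def using lin3_closed by (blast elim: span2E)
qed (simp add: finite_space3)

text \<open>
  The line through \<open>v\<close> and \<open>w\<close> contains the points spanned by \<open>v + a w\<close>, one for each scalar \<open>a\<close>,
  and the point spanned by \<open>w\<close>.
\<close>

lemma card_points_on_line:
  assumes "l \<in> pg_lines F"
  shows "card (carrier F) + 1 \<le> card {p \<in> pg_points F. p \<subseteq> l}"
proof -
  obtain v w where l: "l = span2 F v w" and v: "v \<in> space3 F" "w \<in> space3 F" and ind: "indep3 F v w"
    using assms by (auto simp: pg_lines_def)
  define P where "P a b = span1 F (lin3 F v w a b)" for a b
  have P: "P a b \<in> {p \<in> pg_points F. p \<subseteq> l}"
    if "a \<in> carrier F" "b \<in> carrier F" "a \<noteq> \<zero> \<or> b \<noteq> \<zero>" for a b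
  proof -
    have "lin3 F v w a b \<noteq> zero3 F"
      using ind that unfolding indep3_def lin3_def by blast
    then have "P a b \<in> pg_points F"
      using lin3_closed[OF v that(1,2)] by (simp add: P_def pg_pointsI)
    moreover have "P a b \<subseteq> l"
      unfolding P_def l by (rule span1_subset[OF v that(1,2)])
    ultimately show ?thesis by simp
  qed
  have eqD: "\<exists>c\<in>carrier F. a = c \<otimes> a' \<and> b = c \<otimes> b'"
    if "P a b = P a' b'" "a \<in> carrier F" "b \<in> carrier F" "a' \<in> carrier F" "b' \<in> carrier F" for a b a' b'
  proof -
    have "lin3 F v w a b \<in> P a' b'"
      using mem_span1[OF lin3_closed[OF v that(2,3)]] that(1) by (simp add: P_def)
    then obtain c where c: "c \<in> carrier F" "lin3 F v w a b = scale3 F c (lin3 F v w a' b')"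
      by (auto simp: P_def span1_def)
    then have "lin3 F v w a b = lin3 F v w (c \<otimes> a') (c \<otimes> b')"
      using v that by (simp add: scale3_lin3)
    then have "a = c \<otimes> a' \<and> b = c \<otimes> b'"
      using c that by (intro indep3_lin3_eqD[OF ind v]) auto
    then show ?thesis using c by blast
  qed
  have "inj_on (P \<one>) (carrier F)"
  proof (rule inj_onI)
    fix a b assume ab: "a \<in> carrier F" "b \<in> carrier F" "P \<one> a = P \<one> b"
    then obtain c where c: "c \<in> carrier F" "\<one> = c \<otimes> \<one>" "a = c \<otimes> b"
      using eqD[OF ab(3)] by blast
    then have "c = \<one>" by simp
    then show "a = b" using ab c by simp
  qed
  moreover have "P \<zero> \<one> \<notin> P \<one> ` carrier F"
  proof
    assume "P \<zero> \<one> \<in> P \<one> ` carrier F"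
    then obtain a where a: "a \<in> carrier F" "P \<zero> \<one> = P \<one> a" by blast
    then obtain c where c: "c \<in> carrier F" "\<zero> = c \<otimes> \<one>" "\<one> = c \<otimes> a"
      using eqD[OF a(2)] by blast
    then have "c = \<zero>" by (metis r_one)
    then have "\<one> = \<zero>" using c(3) a(1) l_null by metis
    then show False by simp
  qed
  ultimately have "card (insert (P \<zero> \<one>) (P \<one> ` carrier F)) = card (carrier F) + 1"
    by (simp add: card_image finite_carrier)
  moreover have "card (insert (P \<zero> \<one>) (P \<one> ` carrier F)) \<le> card {p \<in> pg_points F. p \<subseteq> l}"
  proof (rule card_mono)
    show "insert (P \<zero> \<one>) (P \<one> ` carrier F) \<subseteq> {p \<in> pg_points F. p \<subseteq> l}"
      using P by (intro insert_subsetI image_subsetI) simp_all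
  qed (simp add: finite_pg_points)
  ultimately show ?thesis by simp
qed

lemma scale3_eq_zero3:
  assumes "v \<in> space3 F" "a \<in> carrier F" "scale3 F a v = zero3 F" "v \<noteq> zero3 F"
  shows "a = \<zero>"
  using assms by (auto simp: space3_def zero3_def integral_iff)

lemma indep3_of_span1_neq:
  assumes x: "x \<in> space3 F" "y \<in> space3 F" "x \<noteq> zero3 F" "y \<noteq> zero3 F" and neq: "span1 F x \<noteq> span1 F y"
  shows "indep3 F x y"
proof (rule ccontr)
  assume "\<not> indep3 F x y"
  then obtain a b where ab: "a \<in> carrier F" "b \<in> carrier F" "lin3 F x y a b = zero3 F" "a \<noteq> \<zero> \<or> b \<noteq> \<zero>"
    unfolding indep3_def lin3_def by blast
  have "a \<noteq> \<zero>"
  proof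
    assume "a = \<zero>"
    then show False
      using ab x scale3_eq_zero3[of y b] by (simp add: lin3_right)
  qed
  then have ia: "inv a \<in> carrier F" "inv a \<otimes> a = \<one>"
    using ab by (auto simp: field_Units)
  define c where "c = \<ominus> (inv a \<otimes> b)"
  have c: "c \<in> carrier F" using ia ab by (simp add: c_def)
  have coord: "s = c \<otimes> t" if "a \<otimes> s \<oplus> b \<otimes> t = \<zero>" "s \<in> carrier F" "t \<in> carrier F" for s t
  proof -
    have "inv a \<otimes> (a \<otimes> s \<oplus> b \<otimes> t) = s \<oplus> (inv a \<otimes> b) \<otimes> t"
      using ia ab(1,2) that(2,3) by (simp add: r_distr m_assoc[symmetric])
    then have *: "s \<oplus> (inv a \<otimes> b) \<otimes> t = \<zero>" using that(1) ia(1) by (metis r_null)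
    have "\<ominus> ((inv a \<otimes> b) \<otimes> t) = s"
      by (rule minus_equality[OF *]) (use ia ab that in auto)
    then show ?thesis using ia ab that by (simp add: c_def l_minus)
  qed
  have xy: "x = scale3 F c y"
    using ab(3) x coord by (auto simp: lin3_def zero3_def space3_def)
  have "c \<noteq> \<zero>"
    using xy x by (auto simp: space3_def zero3_def)
  then have ic: "inv c \<in> carrier F" "inv c \<otimes> c = \<one>"
    using c by (auto simp: field_Units)
  have yx: "y = scale3 F (inv c) x"
    unfolding xy using x ic c by (simp add: scale3_scale3 scale3_one)
  have "span1 F (scale3 F k z) \<subseteq> span1 F z" if "z \<in> space3 F" "k \<in> carrier F" for k z
    using that by (auto simp: span1_def scale3_scale3)
  then have "span1 F x \<subseteq> span1 F y" "span1 F y \<subseteq> span1 F x"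
    using xy yx x c ic by metis+
  then show False using neq by simp
qed

text \<open>
  A line has at most \<open>q\<^sup>2\<close> vectors, where \<open>q\<close> is the order of the field, and two independent vectors
  of it already span \<open>q\<^sup>2\<close> vectors.
\<close>

lemma line_eq_span2:
  assumes l: "l \<in> pg_lines F" and xy: "x \<in> l" "y \<in> l" and ind: "indep3 F x y"
  shows "l = span2 F x y"
proof -
  obtain v w where lv: "l = span2 F v w" and v: "v \<in> space3 F" "w \<in> space3 F"
    using l by (auto simp: pg_lines_def)
  obtain a b a' b' where x: "x = lin3 F v w a b" "a \<in> carrier F" "b \<in> carrier F"
    and y: "y = lin3 F v w a' b'" "a' \<in> carrier F" "b' \<in> carrier F"
    using xy by (auto simp: lv span2_eq)
  have xs: "x \<in> space3 F" "y \<in> space3 F" using x y v by (auto simp: lin3_closed)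
  have fin: "finite l" by (simp add: lv span2_eq finite_carrier)
  have "card l \<le> card (carrier F \<times> carrier F)"
    unfolding lv span2_eq by (rule card_image_le) (simp add: finite_carrier)
  also have "\<dots> = card (span2 F x y)"
    unfolding span2_eq
    by (rule card_image[symmetric], rule inj_onI) (use indep3_lin3_eqD[OF ind xs] in auto)
  finally have "card l \<le> card (span2 F x y)" .
  moreover have "span2 F x y \<subseteq> l"
  proof
    fix z assume "z \<in> span2 F x y"
    then obtain c d where "c \<in> carrier F" "d \<in> carrier F" "z = lin3 F x y c d" by (rule span2E)
    then show "z \<in> l" using v x y by (simp add: lv lin3_lin3 span2I)
  qed
  ultimately show ?thesis using card_seteq[OF fin] by auto
qed

lemma lines_share_at_most_one_point:
  assumes "l \<in> pg_lines F" "l' \<in> pg_lines F" "p \<in> pg_points F" "p' \<in> pg_points F" "p \<noteq> p'"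
    "p \<subseteq> l" "p' \<subseteq> l" "p \<subseteq> l'" "p' \<subseteq> l'"
  shows "l = l'"
proof -
  obtain x y where p: "p = span1 F x" "p' = span1 F y"
    and x: "x \<in> space3 F" "y \<in> space3 F" "x \<noteq> zero3 F" "y \<noteq> zero3 F"
    using assms(3,4) by (auto simp: pg_points_def)
  have "indep3 F x y" using assms(5) by (intro indep3_of_span1_neq x) (simp add: p)
  moreover have "x \<in> p" "y \<in> p'" using x by (auto simp: p mem_span1)
  ultimately show ?thesis using line_eq_span2[of _ x y] assms by blast
qed

text \<open>
  Dually to the points on a line, the lines through a point correspond to the points of a line that
  avoids it. Such a line is the plane parametrized by \<open>Z\<close>, which is complementary to \<open>v\<close>.
\<close>

lemma card_lines_through_span1:
  assumes v: "v \<in> space3 F"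
  assumes Z: "\<And>s t. s \<in> carrier F \<Longrightarrow> t \<in> carrier F \<Longrightarrow> Z s t \<in> space3 F" "Z \<zero> \<zero> = zero3 F"
  assumes H: "\<And>a b s t s' t'. a \<in> carrier F \<Longrightarrow> b \<in> carrier F \<Longrightarrow> s \<in> carrier F \<Longrightarrow> t \<in> carrier F \<Longrightarrow>
     s' \<in> carrier F \<Longrightarrow> t' \<in> carrier F \<Longrightarrow> lin3 F v (Z s t) a b = Z s' t' \<Longrightarrow>
     a = \<zero> \<and> s' = b \<otimes> s \<and> t' = b \<otimes> t"
  shows "card (carrier F) + 1 \<le> card {l \<in> pg_lines F. span1 F v \<subseteq> l}"
proof -
  define L where "L s t = span2 F v (Z s t)" for s t
  have L: "L s t \<in> {l \<in> pg_lines F. span1 F v \<subseteq> l}"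
    if st: "s \<in> carrier F" "t \<in> carrier F" "s = \<one> \<or> t = \<one>" for s t
  proof -
    have "indep3 F v (Z s t)"
      unfolding indep3_def
    proof (intro ballI impI)
      fix a b assume ab: "a \<in> carrier F" "b \<in> carrier F"
        "add3 F (scale3 F a v) (scale3 F b (Z s t)) = zero3 F"
      then have "a = \<zero> \<and> \<zero> = b \<otimes> s \<and> \<zero> = b \<otimes> t"
        using st by (intro H) (auto simp: lin3_def Z)
      then show "a = \<zero> \<and> b = \<zero>" using st ab by auto
    qed
    then have "L s t \<in> pg_lines F"
      using v Z st by (simp add: L_def pg_linesI)
    moreover have "span1 F v \<subseteq> L s t"
    proof
      fix x assume "x \<in> span1 F v"
      then obtain a where "a \<in> carrier F" "x = lin3 F v (Z s t) a \<zero>"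
        using v Z st by (auto simp: span1_def lin3_left)
      then show "x \<in> L s t" by (auto simp: L_def span2_eq)
    qed
    ultimately show ?thesis by simp
  qed
  have eqD: "\<exists>b\<in>carrier F. s' = b \<otimes> s \<and> t' = b \<otimes> t"
    if "L s' t' = L s t" "s \<in> carrier F" "t \<in> carrier F" "s' \<in> carrier F" "t' \<in> carrier F" for s t s' t'
  proof -
    have "lin3 F v (Z s' t') \<zero> \<one> \<in> L s' t'" by (auto simp: L_def span2_eq)
    then have "Z s' t' \<in> L s t"
      using that v Z by (simp add: lin3_right scale3_one)
    then obtain a b where "a \<in> carrier F" "b \<in> carrier F" "lin3 F v (Z s t) a b = Z s' t'"
      by (auto simp: L_def span2_eq)
    then show ?thesis using H that by blast
  qed
  have "inj_on (L \<one>) (carrier F)"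
  proof (rule inj_onI)
    fix a b assume ab: "a \<in> carrier F" "b \<in> carrier F" "L \<one> a = L \<one> b"
    then obtain c where c: "c \<in> carrier F" "\<one> = c \<otimes> \<one>" "a = c \<otimes> b"
      using eqD[OF ab(3)] by blast
    then have "c = \<one>" by simp
    then show "a = b" using ab c by simp
  qed
  moreover have "L \<zero> \<one> \<notin> L \<one> ` carrier F"
  proof
    assume "L \<zero> \<one> \<in> L \<one> ` carrier F"
    then obtain a where a: "a \<in> carrier F" "L \<zero> \<one> = L \<one> a" by blast
    then obtain c where c: "c \<in> carrier F" "\<zero> = c \<otimes> \<one>" "\<one> = c \<otimes> a"
      using eqD[OF a(2)] by blast
    then have "c = \<zero>" by (metis r_one)
    then have "\<one> = \<zero>" using c(3) a(1) l_null by metis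
    then show False by simp
  qed
  ultimately have "card (insert (L \<zero> \<one>) (L \<one> ` carrier F)) = card (carrier F) + 1"
    by (simp add: card_image finite_carrier)
  moreover have "card (insert (L \<zero> \<one>) (L \<one> ` carrier F)) \<le> card {l \<in> pg_lines F. span1 F v \<subseteq> l}"
  proof (rule card_mono)
    show "insert (L \<zero> \<one>) (L \<one> ` carrier F) \<subseteq> {l \<in> pg_lines F. span1 F v \<subseteq> l}"
      using L by (intro insert_subsetI image_subsetI) simp_all
  qed (simp add: finite_pg_lines)
  ultimately show ?thesis by simp
qed

text \<open>
  If a coordinate of \<open>v\<close> is not 0, the plane on which this coordinate vanishes is complementary
  to \<open>v\<close>.
\<close>

lemma card_lines_through_point:
  assumes "p \<in> pg_points F"
  shows "card (carrier F) + 1 \<le> card {l \<in> pg_lines F. p \<subseteq> l}"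
proof -
  obtain v where p: "p = span1 F v" and v: "v \<in> space3 F" "v \<noteq> zero3 F"
    using assms by (auto simp: pg_points_def)
  obtain x y z where xyz: "v = (x, y, z)" "x \<in> carrier F" "y \<in> carrier F" "z \<in> carrier F"
    using v(1) by (rule space3_cases)
  consider "x \<noteq> \<zero>" | "x = \<zero>" "y \<noteq> \<zero>" | "x = \<zero>" "y = \<zero>" "z \<noteq> \<zero>"
    using v(2) by (auto simp: xyz zero3_def)
  then show ?thesis
  proof cases
    case 1
    show ?thesis unfolding p
      by (rule card_lines_through_span1[OF v(1), of "\<lambda>s t. (\<zero>, s, t)"])
        (use 1 xyz in \<open>auto simp: space3_def zero3_def lin3_def integral_iff\<close>)
  next
    case 2
    show ?thesis unfolding p
      by (rule card_lines_through_span1[OF v(1), of "\<lambda>s t. (s, \<zero>, t)"])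
        (use 2 xyz in \<open>auto simp: space3_def zero3_def lin3_def integral_iff\<close>)
  next
    case 3
    show ?thesis unfolding p
      by (rule card_lines_through_span1[OF v(1), of "\<lambda>s t. (s, t, \<zero>)"])
        (use 3 xyz in \<open>auto simp: space3_def zero3_def lin3_def integral_iff\<close>)
  qed
qed

lemma pg_points_nonempty: "pg_points F \<noteq> {}"
proof -
  have "span1 F (\<one>, \<zero>, \<zero>) \<in> pg_points F"
    by (rule pg_pointsI) (simp_all add: space3_def zero3_def)
  then show ?thesis by blast
qed

lemma finite_pg_flags: "finite (pg_flags F)"
  by (rule finite_subset[of _ "pg_lines F \<times> pg_points F"])
    (auto simp: pg_flags_def finite_pg_lines finite_pg_points)

text \<open>
  The flags can be counted by their lines or by their points. Both counts together bound the number of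
  lines and points in terms of the number of flags, so neither of the two numbers has to be computed.
\<close>

lemma card_pg_flags:
  "card (pg_lines F) * (card (carrier F) + 1) \<le> card (pg_flags F)"
  "card (pg_points F) * (card (carrier F) + 1) \<le> card (pg_flags F)"
proof -
  have "pg_flags F = Sigma (pg_lines F) (\<lambda>l. {p \<in> pg_points F. p \<subseteq> l})"
    by (auto simp: pg_flags_def)
  then have "card (pg_flags F) = (\<Sum>l\<in>pg_lines F. card {p \<in> pg_points F. p \<subseteq> l})"
    by (simp add: finite_pg_lines finite_pg_points)
  also have "\<dots> \<ge> (\<Sum>l\<in>pg_lines F. card (carrier F) + 1)"
    by (intro sum_mono card_points_on_line)
  finally show "card (pg_lines F) * (card (carrier F) + 1) \<le> card (pg_flags F)"
    by simp
  have "pg_flags F = prod.swap ` Sigma (pg_points F) (\<lambda>p. {l \<in> pg_lines F. p \<subseteq> l})"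
    unfolding pg_flags_def by force
  also have "card \<dots> = card (Sigma (pg_points F) (\<lambda>p. {l \<in> pg_lines F. p \<subseteq> l}))"
    by (intro card_image inj_onI) (metis swap_swap)
  also have "\<dots> = (\<Sum>p\<in>pg_points F. card {l \<in> pg_lines F. p \<subseteq> l})"
    by (simp add: finite_pg_lines finite_pg_points)
  also have "\<dots> \<ge> (\<Sum>p\<in>pg_points F. card (carrier F) + 1)"
    by (intro sum_mono card_lines_through_point)
  finally show "card (pg_points F) * (card (carrier F) + 1) \<le> card (pg_flags F)"
    by simp
qed

end

section \<open>The random matrix\<close>

lemma sign_realizable_mono:
  assumes "sign_realizable R C A d" "d \<le> d'"
  shows "sign_realizable R C A d'"
proof -
  obtain u :: "'a \<Rightarrow> nat \<Rightarrow> real" and v :: "'b \<Rightarrow> nat \<Rightarrow> real"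
    where u: "\<forall>r\<in>R. \<exists>i<d. u r i \<noteq> 0" and v: "\<forall>c\<in>C. \<exists>i<d. v c i \<noteq> 0"
      and A: "\<forall>r\<in>R. \<forall>c\<in>C. (A r c = Plus \<longrightarrow> sgn (\<Sum>i<d. u r i * v c i) = 1) \<and>
           (A r c = Minus \<longrightarrow> sgn (\<Sum>i<d. u r i * v c i) = -1)"
    using assms(1) unfolding sign_realizable_def by (elim exE conjE)
  define pad where "pad x i = (if i < d then x i else 0)" for x :: "nat \<Rightarrow> real" and i
  have "\<exists>i<d'. pad x i \<noteq> 0" if "\<exists>i<d. x i \<noteq> 0" for x
    using that assms(2) by (force simp: pad_def)
  moreover have "(\<Sum>i<d'. pad x i * pad y i) = (\<Sum>i<d. x i * y i)" for x y
    using assms(2) by (intro sum.mono_neutral_cong_right) (auto simp: pad_def)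
  ultimately show ?thesis
    unfolding sign_realizable_def using u v A
    by (intro exI[of _ "\<lambda>r. pad (u r)"] exI[of _ "\<lambda>c. pad (v c)"]) simp
qed

text \<open>
  A realization of dimension \<open>d\<close> is an assignment of real values to \<open>(card R + card C) * d\<close>
  variables, the coordinates of the vectors, and the given entries are the signs of quadratic forms in
  these variables, one for each position in \<open>E\<close>. With at least 40 positions for each variable, most of
  the \<open>2 ^ card E\<close> sign patterns do not occur.
\<close>

lemma card_sign_realizable_le:
  fixes R :: "'r set" and C :: "'c set"
  assumes fin: "finite R" "finite C" and E: "E \<subseteq> R \<times> C"
    and dim: "40 * ((card R + card C) * d) \<le> card E"
  defines "\<Omega> \<equiv> PiE_dflt E Star (\<lambda>_. {Plus, Minus})"
  shows "(real (card {\<omega> \<in> \<Omega>. sign_realizable R C (curry \<omega>) d}))\<^sup>2 \<le> 81 * 2 ^ card E"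
proof -
  define X where "X = (R <+> C) \<times> {..<d}"
  define H where "H = {\<omega> \<in> \<Omega>. sign_realizable R C (curry \<omega>) d}"
  define f :: "'r \<times> 'c \<Rightarrow> (('r + 'c) \<times> nat \<Rightarrow> real) \<Rightarrow> real"
    where "f e x = (\<Sum>i<d. x (Inl (fst e), i) * x (Inr (snd e), i))" for e x
  define \<sigma> :: "('r \<times> 'c \<Rightarrow> entry) \<Rightarrow> 'r \<times> 'c \<Rightarrow> real"
    where "\<sigma> \<omega> e = (if \<omega> e = Plus then 1 else -1)" for \<omega> e
  have X: "finite X" "card X = (card R + card C) * d"
    using fin by (simp_all add: X_def card_Plus)
  have E': "finite E" using fin E by (meson finite_SigmaI finite_subset)
  have H: "finite H" unfolding H_def \<Omega>_def using E' by (intro finite_Collect_conjI disjI1 finite_PiE_dflt) auto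
  have entry: "\<omega> e = Plus \<or> \<omega> e = Minus" if "\<omega> \<in> H" "e \<in> E" for \<omega> e
    using that unfolding H_def \<Omega>_def PiE_dflt_def by blast
  have star: "\<omega> e = Star" if "\<omega> \<in> H" "e \<notin> E" for \<omega> e
    using that unfolding H_def \<Omega>_def PiE_dflt_def by blast
  have "real (card H) \<le> 9 * (real (card (exponents X (2 * card E))))\<^sup>2"
  proof (rule card_sign_patterns_le[OF X(1) E' H, where f = f and \<sigma> = \<sigma>])
    fix e assume e: "e \<in> E"
    have "poly_degree_le X (1 + 1) (\<lambda>x. x (Inl (fst e), i) * x (Inr (snd e), i))" if "i \<in> {..<d}" for i
      using e E that X by (intro poly_degree_le_mult poly_degree_le_var) (auto simp: X_def)
    then have "poly_degree_le X (1 + 1) (f e)"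
      unfolding f_def by (rule poly_degree_le_sum)
    then show "poly_degree_le X 2 (f e)" by (simp add: numeral_2_eq_2)
  next
    fix \<omega> assume \<omega>: "\<omega> \<in> H"
    then have "sign_realizable R C (curry \<omega>) d" by (simp add: H_def)
    then obtain u v where uv: "\<forall>r\<in>R. \<forall>c\<in>C.
        (curry \<omega> r c = Plus \<longrightarrow> sgn (\<Sum>i<d. u r i * v c i) = (1::real)) \<and>
        (curry \<omega> r c = Minus \<longrightarrow> sgn (\<Sum>i<d. u r i * v c i) = -1)"
      unfolding sign_realizable_def by (elim exE conjE)
    define x where "x = (\<lambda>(y, i). case y of Inl r \<Rightarrow> u r i | Inr c \<Rightarrow> v c i)"
    have "sgn (f e x) = \<sigma> \<omega> e" if e: "e \<in> E" for e
    proof -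
      obtain r c where rc: "e = (r, c)" "r \<in> R" "c \<in> C" using E e by (cases e) auto
      show ?thesis
        using uv[rule_format, OF rc(2,3)] entry[OF \<omega> e] by (auto simp: f_def \<sigma>_def x_def rc(1))
    qed
    then show "\<exists>x. \<forall>e\<in>E. sgn (f e x) = \<sigma> \<omega> e" by (intro exI[of _ x] ballI)
  next
    fix \<omega> \<omega>' assume \<omega>: "\<omega> \<in> H" "\<omega>' \<in> H" "\<omega> \<noteq> \<omega>'"
    from \<open>\<omega> \<noteq> \<omega>'\<close> obtain e where e: "\<omega> e \<noteq> \<omega>' e" by (auto simp: fun_eq_iff simp del: split_paired_All)
    then have eE: "e \<in> E" using star[OF \<omega>(1)] star[OF \<omega>(2)] by metis
    moreover have "\<sigma> \<omega> e \<noteq> \<sigma> \<omega>' e"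
      using e entry[OF \<omega>(1) eE] entry[OF \<omega>(2) eE] by (auto simp: \<sigma>_def)
    ultimately show "\<exists>e\<in>E. \<sigma> \<omega> e \<noteq> \<sigma> \<omega>' e" by blast
  qed (auto simp: \<sigma>_def)
  then have "(real (card H))\<^sup>2 \<le> (9 * (real (card (exponents X (2 * card E))))\<^sup>2)\<^sup>2"
    by (rule power_mono) simp
  also have "\<dots> = 81 * (real (card (exponents X (2 * card E)))) ^ 4"
    by (simp add: power_mult_distrib)
  also have "\<dots> \<le> 81 * 2 ^ card E"
    using card_exponents_power_le[OF X(1), of "card E"] dim X(2) by simp
  finally show ?thesis by (simp add: H_def)
qed

text \<open>
  The bound on the index holds for every matrix in the support of the distribution. With
  \<open>d = (q + 1) div 80\<close>, a matrix is bad for the sign-rank only if it is realizable in dimension \<open>d\<close>.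
  Each line and each point lies in at least \<open>q + 1\<close> flags and accounts for \<open>d \<le> (q + 1) / 80\<close>
  variables, and each flag belongs to one line and one point; so there are at least 40 flags
  for each variable.
  The square of the probability of a bad matrix is then at most 81 divided by \<open>2 ^ card (pg_flags F)\<close>.
\<close>

lemma (in finite_field) prob_index_and_sign_rank:
  defines "q \<equiv> card (carrier F)"
  assumes \<epsilon>: "0 < \<epsilon>" "81 * (1/2) ^ (q + 1) \<le> \<epsilon>\<^sup>2"
  shows "1 - \<epsilon> \<le> measure_pmf.prob (random_pg_matrix F)
      {A. Z2_index (sign_complex (pg_lines F) (pg_points F) A) flip \<le> 1 \<and>
          1 / 80 * sqrt (real (q\<^sup>2 + q + 1)) \<le> real (sign_rank (pg_lines F) (pg_points F) A)}"
    (is "_ \<le> measure_pmf.prob _ ?Good")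
proof -
  define E where "E = pg_flags F"
  define \<Omega> where "\<Omega> = PiE_dflt E Star (\<lambda>_. {Plus, Minus})"
  define d where "d = (q + 1) div 80"
  define B where "B = {\<omega> \<in> \<Omega>. sign_realizable (pg_lines F) (pg_points F) (curry \<omega>) d}"
  have E: "finite E" "E \<subseteq> pg_lines F \<times> pg_points F"
    using finite_pg_flags by (auto simp: E_def pg_flags_def)
  have \<Omega>: "finite \<Omega>" "card \<Omega> = 2 ^ card E"
    using E by (auto simp: \<Omega>_def card_PiE_dflt numeral_2_eq_2 intro!: finite_PiE_dflt)
  then have "\<Omega> \<noteq> {}" by auto
  have pmf: "random_pg_matrix F = map_pmf curry (pmf_of_set \<Omega>)"
    unfolding random_pg_matrix_def \<Omega>_def E_def
    by (subst Pi_pmf_of_set) (auto simp: finite_pg_flags)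
  have cardE: "q + 1 \<le> card E" "40 * ((card (pg_lines F) + card (pg_points F)) * d) \<le> card E"
  proof -
    have "1 \<le> card (pg_points F)"
      using pg_points_nonempty finite_pg_points by (simp add: Suc_le_eq card_gt_0_iff)
    then have "1 * (q + 1) \<le> card (pg_points F) * (q + 1)" by (rule mult_le_mono1)
    then show "q + 1 \<le> card E"
      using card_pg_flags(2) by (simp add: E_def q_def)
    have "80 * d \<le> q + 1" by (simp add: d_def)
    then have "(card (pg_lines F) + card (pg_points F)) * (80 * d) \<le>
        (card (pg_lines F) + card (pg_points F)) * (q + 1)"
      by (rule mult_le_mono2)
    also have "\<dots> \<le> 2 * card E"
      using card_pg_flags by (simp add: E_def q_def algebra_simps)
    finally have "80 * ((card (pg_lines F) + card (pg_points F)) * d) \<le> 2 * card E"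
      by (simp only: mult.left_commute)
    then show "40 * ((card (pg_lines F) + card (pg_points F)) * d) \<le> card E" by linarith
  qed
  have "(card B)\<^sup>2 \<le> 81 * (2::real) ^ card E"
    unfolding B_def \<Omega>_def
    using card_sign_realizable_le[OF finite_pg_lines finite_pg_points E(2) cardE(2)] by simp
  then have "(card B / 2 ^ card E)\<^sup>2 \<le> 81 * 2 ^ card E / (2 ^ card E)\<^sup>2"
    by (simp add: power_divide divide_right_mono)
  also have "\<dots> = 81 * (1/2) ^ card E"
    by (simp add: power2_eq_square power_divide)
  also have "\<dots> \<le> 81 * (1/2) ^ (q + 1)"
    using cardE(1) by (intro mult_left_mono power_decreasing) auto
  also have "\<dots> \<le> \<epsilon>\<^sup>2" by (rule \<epsilon>(2))
  finally have bad: "card B / 2 ^ card E \<le> \<epsilon>"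
    using \<epsilon>(1) by (intro power2_le_imp_le[of "card B / 2 ^ card E"]) auto
  have good: "curry \<omega> \<in> ?Good" if \<omega>: "\<omega> \<in> \<Omega> - B" for \<omega>
  proof -
    have star: "(l, p) \<in> E" if "curry \<omega> l p \<noteq> Star" for l p
      using that \<omega> by (auto simp: \<Omega>_def PiE_dflt_def)
    have "Z2_index (sign_complex (pg_lines F) (pg_points F) (curry \<omega>)) flip \<le> 1"
    proof (rule Z2_index_sign_complex_le_1[OF finite_pg_lines finite_pg_points])
      fix l l' p p' assume "l \<noteq> l'" "p \<noteq> p'" and
        "curry \<omega> l p \<noteq> Star" "curry \<omega> l p' \<noteq> Star" "curry \<omega> l' p \<noteq> Star" "curry \<omega> l' p' \<noteq> Star"
      then have "(l, p) \<in> E" "(l, p') \<in> E" "(l', p) \<in> E" "(l', p') \<in> E"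
        using star by simp_all
      then show False
        using lines_share_at_most_one_point[of l l' p p'] \<open>l \<noteq> l'\<close> \<open>p \<noteq> p'\<close>
        by (auto simp: E_def pg_flags_def)
    qed
    moreover have "d < sign_rank (pg_lines F) (pg_points F) (curry \<omega>)"
    proof (rule ccontr)
      assume "\<not> d < sign_rank (pg_lines F) (pg_points F) (curry \<omega>)"
      moreover have "sign_realizable (pg_lines F) (pg_points F) (curry \<omega>)
          (sign_rank (pg_lines F) (pg_points F) (curry \<omega>))"
        unfolding sign_rank_def
        by (rule LeastI, rule sign_realizable_card[OF finite_pg_points pg_points_nonempty])
      ultimately have "sign_realizable (pg_lines F) (pg_points F) (curry \<omega>) d"
        using sign_realizable_mono by (metis not_less)
      then show False using \<omega> by (simp add: B_def)
    qed
    moreover have "sqrt (real (q\<^sup>2 + q + 1)) \<le> q + 1"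
      by (rule real_le_lsqrt) (simp_all add: power2_eq_square algebra_simps)
    moreover have "real (q + 1) \<le> 80 * (real d + 1)"
    proof -
      have "q + 1 \<le> 80 * (d + 1)" unfolding d_def by presburger
      then have "real (q + 1) \<le> real (80 * (d + 1))" by (rule of_nat_mono)
      then show ?thesis by simp
    qed
    ultimately show ?thesis by simp
  qed
  have "1 - \<epsilon> \<le> 1 - card B / 2 ^ card E" using bad by simp
  also have "\<dots> = card (\<Omega> - B) / card \<Omega>"
  proof -
    have "B \<subseteq> \<Omega>" by (auto simp: B_def)
    then have "card (\<Omega> - B) = card \<Omega> - card B" "card B \<le> card \<Omega>"
      using \<Omega>(1) finite_subset by (auto intro: card_Diff_subset card_mono)
    then show ?thesis using \<Omega>(2) by (simp add: of_nat_diff diff_divide_distrib)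
  qed
  also have "\<dots> \<le> card (\<Omega> \<inter> curry -` ?Good) / card \<Omega>"
    using good \<Omega> by (intro divide_right_mono of_nat_mono card_mono) auto
  also have "\<dots> = measure_pmf.prob (random_pg_matrix F) ?Good"
    unfolding pmf measure_map_pmf by (rule measure_pmf_of_set[symmetric]) (use \<Omega> \<open>\<Omega> \<noteq> {}\<close> in auto)
  finally show ?thesis .
qed

theorem proposition34:
  shows "\<exists>c::real. c > 0 \<and>
    (\<forall>\<epsilon>::real. \<epsilon> > 0 \<longrightarrow>
      (\<forall>\<^sub>F q::nat in at_top. \<forall>F :: nat ring.
         primepow q \<and> field F \<and> card (carrier F) = q \<longrightarrow>
         measure_pmf.prob (random_pg_matrix F)
           {A. Z2_index (sign_complex (pg_lines F) (pg_points F) A) flip \<le> 1 \<and>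
               real (sign_rank (pg_lines F) (pg_points F) A) \<ge> c * sqrt (real (q^2 + q + 1))}
         \<ge> 1 - \<epsilon>))"
proof (intro exI[of _ "1 / 80"] conjI allI impI)
  fix \<epsilon> :: real assume \<epsilon>: "\<epsilon> > 0"
  have "(\<lambda>q. 81 * (1/2 :: real) ^ (q + 1)) \<longlonglongrightarrow> 81 * 0"
    by (intro tendsto_mult tendsto_const LIMSEQ_ignore_initial_segment LIMSEQ_realpow_zero) auto
  then have "\<forall>\<^sub>F q in at_top. 81 * (1/2 :: real) ^ (q + 1) < \<epsilon>\<^sup>2"
    by (rule order_tendstoD) (use \<epsilon> in simp)
  then show "\<forall>\<^sub>F q::nat in at_top. \<forall>F :: nat ring.
         primepow q \<and> field F \<and> card (carrier F) = q \<longrightarrow>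
         measure_pmf.prob (random_pg_matrix F)
           {A. Z2_index (sign_complex (pg_lines F) (pg_points F) A) flip \<le> 1 \<and>
               real (sign_rank (pg_lines F) (pg_points F) A) \<ge> 1 / 80 * sqrt (real (q^2 + q + 1))}
         \<ge> 1 - \<epsilon>"
  proof eventually_elim
    case (elim q)
    show ?case
    proof (intro allI impI, elim conjE)
      fix F :: "nat ring" assume q: "primepow q" and F: "field F" and card: "card (carrier F) = q"
      have "0 < q" using q by (rule primepow_gt_0_nat)
      then have "finite (carrier F)" using card by (simp add: card_gt_0_iff[symmetric] card_ge_0_finite)
      then interpret finite_field F
        using F by (simp add: finite_field_def finite_field_axioms_def)
      show "measure_pmf.prob (random_pg_matrix F)
           {A. Z2_index (sign_complex (pg_lines F) (pg_points F) A) flip \<le> 1 \<and>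
               real (sign_rank (pg_lines F) (pg_points F) A) \<ge> 1 / 80 * sqrt (real (q^2 + q + 1))}
         \<ge> 1 - \<epsilon>"
        using prob_index_and_sign_rank[OF \<epsilon>] elim unfolding card by simp
    qed
  qed
qed simp

end
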